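(* Let $\mathbb{D}\subset\mathbb{R}^2$ be the open unit disc and let $$G:=\bigcup_{n\in\mathbb{N}}\Big(B\big((n,0),\tfrac{1}{n^2}\big)\cup (n,n+1)\times\big(-\tfrac{1}{2}e^{-e^{n^2}},\tfrac{1}{2}e^{-e^{n^2}}\big)\Big)\subset\mathbb{R}^2,$$ where $\mathbb{N}=\{1,2,3,\dots\}$ and $B(x,r)$ is the open disc of centre $x$ and radius $r$. Then $G$ and $\mathbb{D}$ are simply-connected proper open subsets of the plane which are $C^\infty$-diffeomorphic but not Schwartz equivalent.
   Context: $\mathcal{S}(\mathbb{R}^n)$ is the usual Fréchet space of real-valued Schwartz functions on $\mathbb{R}^n$. For an open $U\subset\mathbb{R}^n$, $\mathcal{S}(U)$ is the closed subspace of those $f\in\mathcal{S}(\mathbb{R}^n)$ such that $f$ and all its partial derivatives vanish at every point of $\mathbb{R}^n\setminus U$, with the induced Fréchet topology; its elements are regarded (by restriction) as smooth functions on $U$. Two open subsets $U,V\subset\mathbb{R}^n$ are called Schwartz equivalent if there exists a $C^\infty$-diffeomorphism $\phi\colon U\to V$ such that $s\mapsto s\circ\phi$ is an isomorphism of Fréchet spaces $\mathcal{S}(V)\to\mathcal{S}(U)$. *)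

theory Defs
  imports "HOL-Analysis.Analysis"
begin

section \<open>Smooth maps\<close>

definition partial_derivative ::
  "'a::euclidean_space \<Rightarrow> ('a \<Rightarrow> 'b::real_normed_vector) \<Rightarrow> 'a \<Rightarrow> 'b" where
  "partial_derivative b f x = vector_derivative (\<lambda>t. f (x + t *\<^sub>R b)) (at 0)"

text \<open>Multi-indices are lists of coordinate vectors, so mixed partials taken in different orders
  are indexed separately; they agree for smooth functions.\<close>

primrec iterated_partial ::
  "'a::euclidean_space list \<Rightarrow> ('a \<Rightarrow> 'b::real_normed_vector) \<Rightarrow> 'a \<Rightarrow> 'b" where
  "iterated_partial [] f = f"
| "iterated_partial (b # bs) f = partial_derivative b (iterated_partial bs f)"

text \<open>Intended for open \<open>U\<close>, where the iterated partials at points of \<open>U\<close> depend only on the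
  values of \<open>f\<close> on \<open>U\<close>. Differentiability is in the Frechet sense, so all the iterated partials
  are also continuous.\<close>

definition smooth_on :: "'a::euclidean_space set \<Rightarrow> ('a \<Rightarrow> 'b::real_normed_vector) \<Rightarrow> bool" where
  "smooth_on U f \<longleftrightarrow> (\<forall>bs. set bs \<subseteq> Basis \<longrightarrow> iterated_partial bs f differentiable_on U)"

definition smooth_diffeomorphism ::
  "'a::euclidean_space set \<Rightarrow> 'b::euclidean_space set \<Rightarrow> ('a \<Rightarrow> 'b) \<Rightarrow> bool" where
  "smooth_diffeomorphism U V \<phi> \<longleftrightarrow>
     bij_betw \<phi> U V \<and> smooth_on U \<phi> \<and> smooth_on V (inv_into U \<phi>)"

definition smoothly_diffeomorphic ::
  "'a::euclidean_space set \<Rightarrow> 'b::euclidean_space set \<Rightarrow> bool" where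
  "smoothly_diffeomorphic U V \<longleftrightarrow> (\<exists>\<phi>. smooth_diffeomorphism U V \<phi>)"


section \<open>Schwartz spaces\<close>

definition schwartz_functions :: "('a::euclidean_space \<Rightarrow> real) set" where
  "schwartz_functions = {f. smooth_on UNIV f \<and>
     (\<forall>k bs. set bs \<subseteq> Basis \<longrightarrow> bounded (range (\<lambda>x. norm x ^ k * \<bar>iterated_partial bs f x\<bar>)))}"

definition schwartz_seminorm ::
  "nat \<Rightarrow> 'a::euclidean_space list \<Rightarrow> ('a \<Rightarrow> real) \<Rightarrow> real" where
  "schwartz_seminorm k bs f = (SUP x. norm x ^ k * \<bar>iterated_partial bs f x\<bar>)"

text \<open>The locally convex topology defined by the seminorms: the open seminorm balls form a
  subbasis.\<close>

definition schwartz_topology :: "('a::euclidean_space \<Rightarrow> real) topology" where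
  "schwartz_topology = topology_generated_by
     {{g \<in> schwartz_functions. schwartz_seminorm k bs (\<lambda>x. g x - f x) < \<epsilon>} | f k bs \<epsilon>.
        f \<in> schwartz_functions \<and> set bs \<subseteq> Basis \<and> \<epsilon> > 0}"

definition schwartz_space_on :: "'a::euclidean_space set \<Rightarrow> ('a \<Rightarrow> real) set" where
  "schwartz_space_on U = {f \<in> schwartz_functions.
     \<forall>bs. set bs \<subseteq> Basis \<longrightarrow> (\<forall>x. x \<notin> U \<longrightarrow> iterated_partial bs f x = 0)}"

definition schwartz_topology_on :: "'a::euclidean_space set \<Rightarrow> ('a \<Rightarrow> real) topology" where
  "schwartz_topology_on U = subtopology schwartz_topology (schwartz_space_on U)"

definition schwartz_isomorphism ::
  "'a::euclidean_space set \<Rightarrow> 'a set \<Rightarrow> (('a \<Rightarrow> real) \<Rightarrow> ('a \<Rightarrow> real)) \<Rightarrow> bool" where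
  "schwartz_isomorphism V U T \<longleftrightarrow>
     (\<forall>s\<in>schwartz_space_on V. \<forall>t\<in>schwartz_space_on V.
        T (\<lambda>y. s y + t y) = (\<lambda>x. T s x + T t x)) \<and>
     (\<forall>c. \<forall>s\<in>schwartz_space_on V. T (\<lambda>y. c * s y) = (\<lambda>x. c * T s x)) \<and>
     homeomorphic_map (schwartz_topology_on V) (schwartz_topology_on U) T"

text \<open>An element of the Schwartz space on \<open>U\<close> vanishes outside \<open>U\<close>, so it is determined by its
  restriction to \<open>U\<close>; a function given on \<open>U\<close>, such as \<open>s \<circ> \<phi>\<close>, represents an element iff its
  extension by zero is one.\<close>

definition schwartz_pullback ::
  "'a::euclidean_space set \<Rightarrow> ('a \<Rightarrow> 'a) \<Rightarrow> ('a \<Rightarrow> real) \<Rightarrow> 'a \<Rightarrow> real" where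
  "schwartz_pullback U \<phi> s = (\<lambda>x. if x \<in> U then s (\<phi> x) else 0)"

definition schwartz_equivalent ::
  "'a::euclidean_space set \<Rightarrow> 'a set \<Rightarrow> bool" where
  "schwartz_equivalent U V \<longleftrightarrow>
     (\<exists>\<phi>. smooth_diffeomorphism U V \<phi> \<and> schwartz_isomorphism V U (schwartz_pullback U \<phi>))"

lemma topspace_schwartz_topology: "topspace schwartz_topology = schwartz_functions"
proof -
  have "f \<in> topspace schwartz_topology" if f: "f \<in> schwartz_functions" for f :: "'a \<Rightarrow> real"
  proof -
    have "f \<in> {g \<in> schwartz_functions.
        schwartz_seminorm 0 [] (\<lambda>x. g x - f x) < schwartz_seminorm 0 [] (\<lambda>x. f x - f x) + 1}"
      using f by simp
    moreover have "schwartz_seminorm 0 [] (\<lambda>x. f x - f x) + 1 > 0"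
      by (simp add: schwartz_seminorm_def)
    moreover have "set ([] :: 'a list) \<subseteq> Basis"
      by simp
    ultimately show ?thesis
      unfolding schwartz_topology_def topology_generated_by_topspace using f by blast
  qed
  then show ?thesis
    unfolding schwartz_topology_def topology_generated_by_topspace by blast
qed

lemma topspace_schwartz_topology_on: "topspace (schwartz_topology_on U) = schwartz_space_on U"
  by (auto simp: schwartz_topology_on_def topspace_schwartz_topology schwartz_space_on_def)


section \<open>The planar domains\<close>

text \<open>The type \<^typ>\<open>real \<times> real\<close> carries the Euclidean norm, so \<open>ball\<close> is a round disc.\<close>

abbreviation unit_disc :: "(real \<times> real) set" where
  "unit_disc \<equiv> ball (0, 0) 1"

definition G_domain :: "(real \<times> real) set" where
  "G_domain = (\<Union>n\<in>{1::nat..}.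
     ball (real n, 0) (1 / real n ^ 2) \<union>
     {real n <..< real n + 1} \<times>
       {- (1/2) * exp (- exp (real n ^ 2)) <..< (1/2) * exp (- exp (real n ^ 2))})"

end

theory Submission
  imports Defs "HOL-Complex_Analysis.Riemann_Mapping"
begin

text \<open>Shrinking the second coordinate contracts \<^term>\<open>G_domain\<close> onto the positive half-axis, so the
  Riemann mapping theorem gives a diffeomorphism onto the disc.

  For the second part, let \<open>T s = s \<circ> \<phi>\<close> be continuous from the Schwartz space of \<open>V\<close> to that
  of \<open>U\<close>. The first derivatives of \<open>T s\<close> are bounded by finitely many seminorms of \<open>s\<close>, and \<open>T s\<close>
  vanishes off \<open>U\<close>. Testing on a bump of radius \<open>r\<close> at \<open>\<phi> x\<close>, scaled so that it lives in \<open>V\<close>,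
  gives a lower bound for the distance of \<open>x\<close> to the complement of \<open>U\<close> which is polynomial in
  \<open>r / (1 + norm (\<phi> x))\<close>. Applied to \<open>T\<close> inverse, this shows that \<open>\<phi> (n, 0)\<close> has distance at least
  a negative power of \<open>n\<close> to the circle. The disc around \<open>0\<close> through \<open>\<phi> (n, 0)\<close> is connected, so the
  preimage of some point in it lies in the neck at abscissa \<open>n - 1/2\<close>; the estimate for \<open>T\<close> then
  bounds the width of the neck below by a negative power of \<open>n\<close>, while it is doubly exponentially
  small.\<close>

section \<open>Seminorm estimates\<close>

lemma partial_derivative_eq:
  assumes "(f has_derivative f') (at x)"
  shows "partial_derivative b f x = f' b"
proof -
  have "((\<lambda>t. x + t *\<^sub>R b) has_vector_derivative b) (at 0)"
    by (auto intro!: derivative_eq_intros)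
  moreover have "(f has_derivative f') (at (x + 0 *\<^sub>R b))"
    using assms by simp
  ultimately have "((\<lambda>t. f (x + t *\<^sub>R b)) has_derivative (\<lambda>t. f' (t *\<^sub>R b))) (at 0)"
    unfolding has_vector_derivative_def
    by (rule has_derivative_compose)
  then have "((\<lambda>t. f (x + t *\<^sub>R b)) has_vector_derivative f' b) (at 0)"
    unfolding has_vector_derivative_def
    using linear_cmul[OF has_derivative_linear[OF assms]] by simp
  then show ?thesis
    unfolding partial_derivative_def by (rule vector_derivative_at)
qed

text \<open>Only parameters near 0 matter, and for those the line through \<open>x\<close> in
  direction \<open>b\<close> stays in the open set \<open>U\<close>.\<close>

lemma partial_derivative_cong:
  assumes "open U" "x \<in> U" "\<And>y. y \<in> U \<Longrightarrow> f y = g y"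
  shows "partial_derivative b f x = partial_derivative b g x"
proof -
  have "((\<lambda>t. x + t *\<^sub>R b) \<longlongrightarrow> x + 0 *\<^sub>R b) (nhds 0)"
    by (intro tendsto_intros filterlim_ident)
  then have "eventually (\<lambda>t. x + t *\<^sub>R b \<in> U) (nhds (0::real))"
    using assms(1,2) by (auto dest: topological_tendstoD)
  then show ?thesis
    unfolding partial_derivative_def
    by (intro vector_derivative_cong_eq) (auto elim!: eventually_mono simp: assms(3))
qed

lemma iterated_partial_cong:
  assumes "open U" "\<And>y. y \<in> U \<Longrightarrow> f y = g y" "x \<in> U"
  shows "iterated_partial bs f x = iterated_partial bs g x"
  using assms(3)
proof (induction bs arbitrary: x)
  case (Cons b bs)
  then show ?case
    unfolding iterated_partial.simps by (intro partial_derivative_cong[OF assms(1)]) auto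
qed (simp add: assms(2))

lemma differentiable_on_transform:
  assumes "f differentiable_on S" "\<And>x. x \<in> S \<Longrightarrow> f x = g x"
  shows "g differentiable_on S"
  unfolding differentiable_on_def
proof
  fix x assume x: "x \<in> S"
  show "g differentiable at x within S"
    by (rule differentiable_transform_within[where f = f, OF _ zero_less_one x])
      (use assms x in \<open>auto simp: differentiable_on_def\<close>)
qed

lemma smooth_on_cong:
  assumes "open U" "\<And>y. y \<in> U \<Longrightarrow> f y = g y" "smooth_on U f"
  shows "smooth_on U g"
  unfolding smooth_on_def
proof (intro allI impI)
  fix bs :: "'a list" assume "set bs \<subseteq> Basis"
  then have "iterated_partial bs f differentiable_on U"
    using assms(3) by (simp add: smooth_on_def)
  then show "iterated_partial bs g differentiable_on U"
    by (rule differentiable_on_transform) (rule iterated_partial_cong[OF assms(1,2)])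
qed

lemma smooth_on_UNIV_differentiable:
  assumes "smooth_on UNIV f" "set bs \<subseteq> Basis"
  shows "iterated_partial bs f differentiable (at x)"
  using assms by (simp add: smooth_on_def differentiable_on_def)

lemma iterated_partial_lincomb:
  fixes f g :: "'a::euclidean_space \<Rightarrow> real"
  assumes "smooth_on UNIV f" "smooth_on UNIV g" "set bs \<subseteq> Basis"
  shows "iterated_partial bs (\<lambda>x. a * f x + c * g x) =
         (\<lambda>x. a * iterated_partial bs f x + c * iterated_partial bs g x)"
  using assms(3)
proof (induction bs)
  case (Cons b bs)
  show ?case
  proof
    fix x
    from Cons.prems have bs: "set bs \<subseteq> Basis" by simp
    obtain f' where f': "(iterated_partial bs f has_derivative f') (at x)"
      using smooth_on_UNIV_differentiable[OF assms(1) bs] by (auto simp: differentiable_def)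
    obtain g' where g': "(iterated_partial bs g has_derivative g') (at x)"
      using smooth_on_UNIV_differentiable[OF assms(2) bs] by (auto simp: differentiable_def)
    have "((\<lambda>x. a * iterated_partial bs f x + c * iterated_partial bs g x) has_derivative
        (\<lambda>h. a * f' h + c * g' h)) (at x)"
      using f' g' by (auto intro!: derivative_eq_intros)
    from partial_derivative_eq[OF this] partial_derivative_eq[OF f'] partial_derivative_eq[OF g']
    show "iterated_partial (b # bs) (\<lambda>x. a * f x + c * g x) x =
         a * iterated_partial (b # bs) f x + c * iterated_partial (b # bs) g x"
      using Cons.IH[OF bs] by simp
  qed
qed simp

lemma smooth_on_lincomb:
  fixes f g :: "'a::euclidean_space \<Rightarrow> real"
  assumes "smooth_on UNIV f" "smooth_on UNIV g"
  shows "smooth_on UNIV (\<lambda>x. a * f x + c * g x)"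
  using assms unfolding smooth_on_def
  by (auto simp: iterated_partial_lincomb[OF assms]
      intro!: differentiable_on_add differentiable_on_mult)

section \<open>Schwartz seminorms of linear combinations\<close>

lemma schwartz_seminorm_upper:
  assumes "f \<in> schwartz_functions" "set bs \<subseteq> Basis"
  shows "norm x ^ k * \<bar>iterated_partial bs f x\<bar> \<le> schwartz_seminorm k bs f"
  unfolding schwartz_seminorm_def
  using assms by (intro cSUP_upper bounded_imp_bdd_above) (auto simp: schwartz_functions_def)

lemma schwartz_seminorm_least:
  assumes "\<And>x. norm x ^ k * \<bar>iterated_partial bs f x\<bar> \<le> B"
  shows "schwartz_seminorm k bs f \<le> B"
  unfolding schwartz_seminorm_def using assms by (intro cSUP_least) auto

lemma schwartz_functionsI:
  assumes "smooth_on UNIV f"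
    "\<And>k bs. set bs \<subseteq> Basis \<Longrightarrow> \<exists>B. \<forall>x. norm x ^ k * \<bar>iterated_partial bs f x\<bar> \<le> B"
  shows "f \<in> schwartz_functions"
  using assms unfolding schwartz_functions_def bounded_iff
  by (auto simp: abs_mult)

lemma lincomb_partial_bound:
  assumes f: "f \<in> schwartz_functions" and g: "g \<in> schwartz_functions" and bs: "set bs \<subseteq> Basis"
  shows "norm x ^ k * \<bar>iterated_partial bs (\<lambda>x. a * f x + c * g x) x\<bar> \<le>
         \<bar>a\<bar> * schwartz_seminorm k bs f + \<bar>c\<bar> * schwartz_seminorm k bs g"
proof -
  have sm: "smooth_on UNIV f" "smooth_on UNIV g"
    using f g by (auto simp: schwartz_functions_def)
  have "norm x ^ k * \<bar>iterated_partial bs (\<lambda>x. a * f x + c * g x) x\<bar> \<le>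
      norm x ^ k * (\<bar>a\<bar> * \<bar>iterated_partial bs f x\<bar> + \<bar>c\<bar> * \<bar>iterated_partial bs g x\<bar>)"
    unfolding iterated_partial_lincomb[OF sm bs]
    by (intro mult_left_mono order_trans[OF abs_triangle_ineq]) (auto simp: abs_mult)
  also have "\<dots> = \<bar>a\<bar> * (norm x ^ k * \<bar>iterated_partial bs f x\<bar>)
      + \<bar>c\<bar> * (norm x ^ k * \<bar>iterated_partial bs g x\<bar>)"
    by (simp add: algebra_simps)
  also have "\<dots> \<le> \<bar>a\<bar> * schwartz_seminorm k bs f + \<bar>c\<bar> * schwartz_seminorm k bs g"
    by (intro add_mono mult_left_mono schwartz_seminorm_upper f g bs) auto
  finally show ?thesis .
qed

lemma schwartz_functions_lincomb:
  assumes "f \<in> schwartz_functions" "g \<in> schwartz_functions"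
  shows "(\<lambda>x. a * f x + c * g x) \<in> schwartz_functions"
proof (rule schwartz_functionsI)
  show "smooth_on UNIV (\<lambda>x. a * f x + c * g x)"
    using assms by (intro smooth_on_lincomb) (auto simp: schwartz_functions_def)
qed (use lincomb_partial_bound[OF assms] in blast)

lemma schwartz_seminorm_lincomb:
  assumes "f \<in> schwartz_functions" "g \<in> schwartz_functions" "set bs \<subseteq> Basis"
  shows "schwartz_seminorm k bs (\<lambda>x. a * f x + c * g x) \<le>
         \<bar>a\<bar> * schwartz_seminorm k bs f + \<bar>c\<bar> * schwartz_seminorm k bs g"
  by (intro schwartz_seminorm_least lincomb_partial_bound assms)

lemma schwartz_space_on_scale:
  assumes "s \<in> schwartz_space_on U"
  shows "(\<lambda>x. a * s x) \<in> schwartz_space_on U"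
proof -
  have s: "s \<in> schwartz_functions" "smooth_on UNIV s"
    using assms by (auto simp: schwartz_space_on_def schwartz_functions_def)
  have "(\<lambda>x. a * s x) \<in> schwartz_functions"
    using schwartz_functions_lincomb[OF s(1) s(1), of a 0] by simp
  moreover have "iterated_partial bs (\<lambda>x. a * s x) x = a * iterated_partial bs s x"
    if "set bs \<subseteq> Basis" for bs x
    using iterated_partial_lincomb[OF s(2) s(2) that, of a 0] by simp
  ultimately show ?thesis
    using assms by (auto simp: schwartz_space_on_def)
qed

section \<open>Continuity at zero in terms of finitely many seminorms\<close>

text \<open>Induction over the generation of the topology from its subbasis: a subbasic ball
  containing 0 contains a seminorm ball around 0 by the triangle inequality, and an intersection
  takes the larger \<open>K\<close> and the smaller radius. One number \<open>K\<close> limits both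
  the weight exponent and the order of differentiation, so only finitely many seminorms are
  involved.\<close>

lemma schwartz_topology_nhd_zero:
  fixes W :: "('a::euclidean_space \<Rightarrow> real) set"
  assumes "openin schwartz_topology W" "(\<lambda>_::'a. 0) \<in> W"
  shows "\<exists>K. \<exists>\<delta>>0. \<forall>g\<in>schwartz_functions.
     (\<forall>k bs. k \<le> K \<and> length bs \<le> K \<and> set bs \<subseteq> Basis \<longrightarrow> schwartz_seminorm k bs g < \<delta>) \<longrightarrow> g \<in> W"
proof -
  let ?small = "\<lambda>K \<delta> g. \<forall>k bs. k \<le> K \<and> length bs \<le> K \<and> set bs \<subseteq> Basis \<longrightarrow>
    schwartz_seminorm k bs g < (\<delta>::real)"
  let ?P = "\<lambda>W. \<exists>K. \<exists>\<delta>>0. \<forall>g\<in>schwartz_functions. ?small K \<delta> g \<longrightarrow> g \<in> W"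
  show "?P W"
    using openin_topology_generated_by[OF assms(1)[unfolded schwartz_topology_def]] assms(2)
  proof (induction W rule: generate_topology_on.induct)
    case (Int a b)
    from Int obtain K1 \<delta>1 K2 \<delta>2 where *: "\<delta>1 > 0" "\<delta>2 > 0"
      "\<forall>g\<in>schwartz_functions. ?small K1 \<delta>1 g \<longrightarrow> g \<in> a"
      "\<forall>g\<in>schwartz_functions. ?small K2 \<delta>2 g \<longrightarrow> g \<in> b"
      by auto
    show ?case
    proof (intro exI[of _ "max K1 K2"] exI[of _ "min \<delta>1 \<delta>2"] conjI ballI impI)
      fix g :: "'a \<Rightarrow> real" assume g: "g \<in> schwartz_functions"
        and "?small (max K1 K2) (min \<delta>1 \<delta>2) g"
      then have "?small K1 \<delta>1 g" "?small K2 \<delta>2 g" by (auto simp: le_max_iff_disj)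
      then show "g \<in> a \<inter> b" using * g by blast
    qed (use * in auto)
  next
    case (UN X)
    then obtain k where k: "k \<in> X" "(\<lambda>_::'a. 0) \<in> k" by blast
    with UN have "?P k" by blast
    with k show ?case by blast
  next
    case (Basis s)
    then obtain f k bs \<epsilon> where s: "s = {g \<in> schwartz_functions.
        schwartz_seminorm k bs (\<lambda>x. g x - f x) < \<epsilon>}"
      and f: "f \<in> schwartz_functions" and bs: "set bs \<subseteq> Basis" by blast
    \<comment> \<open>The room that the zero function leaves in the ball around \<open>f\<close>; it
      is positive because 0 belongs to \<open>s\<close>.\<close>
    define \<delta> where "\<delta> = \<epsilon> - schwartz_seminorm k bs (\<lambda>x. 0 - f x)"
    have z: "(\<lambda>_::'a. 0) \<in> schwartz_functions"
      using schwartz_functions_lincomb[OF f f, of 0 0] by simp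
    have f': "(\<lambda>x. 0 - f x) \<in> schwartz_functions"
      using schwartz_functions_lincomb[OF z f, of 1 "-1"] by simp
    show ?case
    proof (intro exI[of _ "max k (length bs)"] exI[of _ \<delta>] conjI ballI impI)
      show "\<delta> > 0" using Basis by (simp add: s \<delta>_def)
    next
      fix g :: "'a \<Rightarrow> real" assume g: "g \<in> schwartz_functions"
        and small: "?small (max k (length bs)) \<delta> g"
      have "schwartz_seminorm k bs (\<lambda>x. g x - f x) \<le>
          schwartz_seminorm k bs g + schwartz_seminorm k bs (\<lambda>x. 0 - f x)"
        using schwartz_seminorm_lincomb[OF g f' bs, of k 1 1] by simp
      also have "\<dots> < \<epsilon>" using small bs by (auto simp: \<delta>_def algebra_simps)
      finally show "g \<in> s" using g by (simp add: s)
    qed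
  qed auto
qed

text \<open>The usual scaling argument: the preimage of a unit seminorm ball contains a basic
  neighbourhood of 0, and homogeneity moves any \<open>s\<close> into it. A common bound
  \<open>A > 0\<close> stands in for the maximum of the seminorms of \<open>s\<close>, which avoids
  dividing by a vanishing seminorm.\<close>

lemma seminorm_bound_if_continuous:
  fixes U V :: "'a::euclidean_space set"
  assumes cont: "continuous_map (schwartz_topology_on V) (schwartz_topology_on U) T"
    and scale: "\<And>c s. s \<in> schwartz_space_on V \<Longrightarrow> T (\<lambda>y. c * s y) = (\<lambda>x. c * T s x)"
    and bs0: "set bs\<^sub>0 \<subseteq> Basis"
  obtains K C where "C > 0"
    "\<And>s A. \<lbrakk>s \<in> schwartz_space_on V; A > 0;
        \<And>k bs. \<lbrakk>k \<le> K; length bs \<le> K; set bs \<subseteq> Basis\<rbrakk> \<Longrightarrow> schwartz_seminorm k bs s \<le> A\<rbrakk> \<Longrightarrow>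
      schwartz_seminorm k\<^sub>0 bs\<^sub>0 (T s) \<le> C * A"
\<comment> \<open>The zero function is obtained as 0 times some element, which requires an element
  to start from.\<close>
proof (cases "schwartz_space_on V = {}")
  case True
  then show ?thesis using that[of 1 0] by simp
next
  case False
  then obtain s0 where s0: "s0 \<in> schwartz_space_on V" by blast
  have z: "(\<lambda>_::'a. 0) \<in> schwartz_space_on V"
    using schwartz_space_on_scale[OF s0, of 0] by simp
  have z': "(\<lambda>_::'a. 0) \<in> schwartz_functions"
    using z unfolding schwartz_space_on_def by blast
  have T0: "T (\<lambda>_::'a. 0) = (\<lambda>_. 0)"
    using scale[OF z, of 0] by simp
  have TU: "T s \<in> schwartz_space_on U" if "s \<in> schwartz_space_on V" for s
    using continuous_map_image_subset_topspace[OF cont] that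
    by (auto simp: topspace_schwartz_topology_on)
  have TS: "T s \<in> schwartz_functions" if "s \<in> schwartz_space_on V" for s
    using TU[OF that] by (simp add: schwartz_space_on_def)
  \<comment> \<open>The subtraction of 0 matches the form of the subbasic sets, here with centre
    0.\<close>
  define B where "B = {g \<in> schwartz_functions. schwartz_seminorm k\<^sub>0 bs\<^sub>0 (\<lambda>x. g x - 0) < 1}"
  have sem0: "schwartz_seminorm k\<^sub>0 bs\<^sub>0 (\<lambda>_::'a. 0) \<le> 0"
    using schwartz_seminorm_lincomb[OF z' z' bs0, of k\<^sub>0 0 0] by simp
  have "openin schwartz_topology B"
    unfolding B_def schwartz_topology_def
    by (rule topology_generated_by_Basis, rule CollectI,
        rule exI[of _ "\<lambda>_. 0"], rule exI[of _ k\<^sub>0], rule exI[of _ bs\<^sub>0], rule exI[of _ 1])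
       (use z' bs0 in simp)
  then have "openin (schwartz_topology_on U) (B \<inter> schwartz_space_on U)"
    unfolding schwartz_topology_on_def openin_subtopology by blast
  from openin_continuous_map_preimage[OF cont this]
  have "openin (schwartz_topology_on V) {s \<in> schwartz_space_on V. T s \<in> B \<inter> schwartz_space_on U}"
    by (simp only: topspace_schwartz_topology_on)
  then obtain W where W: "openin schwartz_topology W"
    "{s \<in> schwartz_space_on V. T s \<in> B \<inter> schwartz_space_on U} = W \<inter> schwartz_space_on V"
    unfolding schwartz_topology_on_def openin_subtopology by blast
  have "(\<lambda>_::'a. 0) \<in> B" using z' sem0 by (auto simp: B_def)
  then have "(\<lambda>_::'a. 0) \<in> {s \<in> schwartz_space_on V. T s \<in> B \<inter> schwartz_space_on U}"
    using z TU[OF z] T0 by (simp only: mem_Collect_eq Int_iff simp_thms)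
  then have "(\<lambda>_::'a. 0) \<in> W" unfolding W(2) by (rule IntD1)
  from schwartz_topology_nhd_zero[OF W(1) this]
  obtain K \<delta> where \<delta>: "\<delta> > 0" and K: "\<forall>g\<in>schwartz_functions.
     (\<forall>k bs. k \<le> K \<and> length bs \<le> K \<and> set bs \<subseteq> Basis \<longrightarrow> schwartz_seminorm k bs g < \<delta>) \<longrightarrow> g \<in> W"
    by (elim exE conjE)
  show ?thesis
  proof (rule that[of "2 / \<delta>" K])
    fix s A assume s: "s \<in> schwartz_space_on V" and A: "A > (0::real)"
      and sA: "\<And>k bs. \<lbrakk>k \<le> K; length bs \<le> K; set bs \<subseteq> Basis\<rbrakk> \<Longrightarrow> schwartz_seminorm k bs s \<le> A"
    have sS: "s \<in> schwartz_functions" using s by (simp add: schwartz_space_on_def)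
    \<comment> \<open>This factor brings all seminorms up to \<open>K\<close> down to at most
      \<open>\<delta> / 2\<close>; its inverse \<open>2 * A / \<delta>\<close> yields the constant
      \<open>2 / \<delta>\<close>.\<close>
    define c where "c = \<delta> / (2 * A)"
    have c: "c > 0" using \<delta> A by (simp add: c_def)
    define t where "t = (\<lambda>x. c * s x)"
    have t: "t \<in> schwartz_space_on V" "t \<in> schwartz_functions"
      using schwartz_space_on_scale[OF s] by (auto simp: t_def schwartz_space_on_def)
    have "t \<in> W"
    proof (rule K[rule_format, OF t(2)])
      fix k and bs :: "'a list" assume "k \<le> K \<and> length bs \<le> K \<and> set bs \<subseteq> Basis"
      then have *: "k \<le> K" "length bs \<le> K" "set bs \<subseteq> Basis" by auto
      have "schwartz_seminorm k bs t \<le> c * schwartz_seminorm k bs s"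
        using schwartz_seminorm_lincomb[OF sS sS *(3), of k c 0] c by (simp add: t_def)
      also have "\<dots> \<le> c * A"
        using sA[OF *] c by simp
      also have "\<dots> < \<delta>" using \<delta> A by (simp add: c_def)
      finally show "schwartz_seminorm k bs t < \<delta>" .
    qed
    then have "T t \<in> B" using W(2) t by blast
    then have less: "schwartz_seminorm k\<^sub>0 bs\<^sub>0 (T t) < 1" by (simp add: B_def)
    have "T s = (\<lambda>x. (1 / c) * T t x)"
      using scale[OF s, of c] c by (simp add: t_def)
    then have "schwartz_seminorm k\<^sub>0 bs\<^sub>0 (T s) \<le> (1 / c) * schwartz_seminorm k\<^sub>0 bs\<^sub>0 (T t)"
      using schwartz_seminorm_lincomb[OF TS[OF t(1)] TS[OF t(1)] bs0, of k\<^sub>0 "1 / c" 0] c by simp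
    also have "\<dots> \<le> (1 / c) * 1" using less c by (intro mult_left_mono) auto
    finally show "schwartz_seminorm k\<^sub>0 bs\<^sub>0 (T s) \<le> 2 / \<delta> * A"
      by (simp add: c_def)
  qed (use \<delta> in simp)
qed

text \<open>Mean value inequality, with the derivative expanded along the coordinate directions. It
  makes vanishing at a point \<open>z\<close> quantitative: a function that vanishes there and
  equals 1 at \<open>x\<close> has a gradient of size at least about \<open>1 / dist x z\<close>
  somewhere.\<close>

lemma lipschitz_bound_by_seminorms:
  assumes f: "f \<in> schwartz_functions"
  shows "\<bar>f x - f z\<bar> \<le> dist x z * (\<Sum>b\<in>Basis. schwartz_seminorm 0 [b] f)"
proof -
  define f' where "f' = (\<lambda>x. frechet_derivative f (at x))"
  have der: "(f has_derivative f' x) (at x)" for x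
    using f smooth_on_UNIV_differentiable[of f "[]"]
    by (simp add: f'_def schwartz_functions_def frechet_derivative_works)
  have "\<bar>f' x h\<bar> \<le> (\<Sum>b\<in>Basis. schwartz_seminorm 0 [b] f) * norm h" for x h
  proof -
    have "f' x h = f' x (\<Sum>b\<in>Basis. (h \<bullet> b) *\<^sub>R b)" by (simp add: euclidean_representation)
    also have "\<dots> = (\<Sum>b\<in>Basis. (h \<bullet> b) * f' x b)"
      using has_derivative_linear[OF der] by (simp add: linear_sum linear_cmul)
    finally have "\<bar>f' x h\<bar> \<le> (\<Sum>b\<in>Basis. \<bar>(h \<bullet> b) * f' x b\<bar>)"
      by simp
    also have "\<dots> \<le> (\<Sum>b\<in>Basis. norm h * schwartz_seminorm 0 [b] f)"
    proof (rule sum_mono)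
      fix b :: 'a assume b: "b \<in> Basis"
      have "\<bar>f' x b\<bar> \<le> schwartz_seminorm 0 [b] f"
        using schwartz_seminorm_upper[OF f, of "[b]" x 0] partial_derivative_eq[OF der] b by simp
      then show "\<bar>(h \<bullet> b) * f' x b\<bar> \<le> norm h * schwartz_seminorm 0 [b] f"
        unfolding abs_mult using Basis_le_norm[OF b] by (intro mult_mono) auto
    qed
    finally show ?thesis by (simp add: sum_distrib_left mult.commute)
  qed
  then have "onorm (f' x) \<le> (\<Sum>b\<in>Basis. schwartz_seminorm 0 [b] f)" for x
    by (intro onorm_le) simp
  then have "norm (f x - f z) \<le> (\<Sum>b\<in>Basis. schwartz_seminorm 0 [b] f) * norm (x - z)"
    by (intro differentiable_bound[of UNIV f f']) (auto simp: der)
  then show ?thesis by (simp add: dist_norm mult.commute)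
qed

section \<open>Bump functions\<close>

text \<open>The derivative is an existential witness rather than \<open>deriv f\<close>, so that the
  closure properties are plain inductions in which the derivative is written down.\<close>

primrec times_differentiable :: "nat \<Rightarrow> (real \<Rightarrow> real) \<Rightarrow> bool" where
  "times_differentiable 0 f = True"
| "times_differentiable (Suc n) f =
    (\<exists>f'. (\<forall>t. (f has_real_derivative f' t) (at t)) \<and> times_differentiable n f')"

lemma times_differentiable_Suc_imp:
  "times_differentiable (Suc n) f \<Longrightarrow> times_differentiable n f"
proof (induction n arbitrary: f)
  case (Suc n)
  from Suc.prems obtain f' where
    "\<forall>t. (f has_real_derivative f' t) (at t)" "times_differentiable (Suc n) f'"
    unfolding times_differentiable.simps(2)[of "Suc n"] by blast
  then show ?case using Suc.IH[of f'] unfolding times_differentiable.simps(2)[of n f] by blast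
qed simp

lemma times_differentiable_add:
  "\<lbrakk>times_differentiable n f; times_differentiable n g\<rbrakk> \<Longrightarrow> times_differentiable n (\<lambda>t. f t + g t)"
proof (induction n arbitrary: f g)
  case (Suc n)
  then obtain f' g' where
    *: "\<forall>t. (f has_real_derivative f' t) (at t)" "\<forall>t. (g has_real_derivative g' t) (at t)"
      "times_differentiable n f'" "times_differentiable n g'"
    by auto
  have "\<forall>t. ((\<lambda>t. f t + g t) has_real_derivative f' t + g' t) (at t)"
    using *(1,2) by (auto intro!: derivative_eq_intros)
  then show ?case using Suc.IH[OF *(3,4)] by auto
qed simp

lemma times_differentiable_mult:
  "\<lbrakk>times_differentiable n f; times_differentiable n g\<rbrakk> \<Longrightarrow> times_differentiable n (\<lambda>t. f t * g t)"
proof (induction n arbitrary: f g)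
  case (Suc n)
  then obtain f' g' where
    *: "\<forall>t. (f has_real_derivative f' t) (at t)" "\<forall>t. (g has_real_derivative g' t) (at t)"
      "times_differentiable n f'" "times_differentiable n g'"
    by auto
  have "\<forall>t. ((\<lambda>t. f t * g t) has_real_derivative f' t * g t + g' t * f t) (at t)"
    using *(1,2) by (auto intro!: DERIV_mult)
  \<comment> \<open>The product rule leaves one factor undifferentiated, so \<open>f\<close> and
    \<open>g\<close> are also needed at the lower order \<open>n\<close>.\<close>
  moreover have "times_differentiable n (\<lambda>t. f' t * g t + g' t * f t)"
    using Suc times_differentiable_Suc_imp * by (intro times_differentiable_add) blast+
  ultimately show ?case by auto
qed simp

text \<open>The factor \<open>c\<close> makes the induction go through: the chain rule produces a
  factor \<open>b\<close>, which is absorbed into it.\<close>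

lemma times_differentiable_affine:
  "times_differentiable n f \<Longrightarrow> times_differentiable n (\<lambda>t. c * f (a + b * t))"
proof (induction n arbitrary: f c)
  case (Suc n)
  then obtain f' where
    *: "\<And>t. (f has_real_derivative f' t) (at t)" "times_differentiable n f'"
    by auto
  have "((\<lambda>t. c * f (a + b * t)) has_real_derivative (c * b) * f' (a + b * t)) (at t)" for t
    by (rule derivative_eq_intros DERIV_chain2[OF *(1)] refl | simp)+
  then show ?case
    using Suc.IH[OF *(2)] by (auto intro!: exI[of _ "\<lambda>t. (c * b) * f' (a + b * t)"])
qed simp

text \<open>Derivatives are unique, so the witnesses for the different orders all coincide with
  \<open>deriv f\<close>.\<close>

lemma times_differentiable_deriv:
  assumes "\<And>n. times_differentiable n f"
  shows "(f has_real_derivative deriv f t) (at t)" "times_differentiable n (deriv f)"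
proof -
  obtain f' where f': "\<And>t. (f has_real_derivative f' t) (at t)" "times_differentiable n f'"
    using assms[of "Suc n"] by auto
  have "f' = deriv f" using DERIV_imp_deriv[OF f'(1)] by auto
  with f' show "(f has_real_derivative deriv f t) (at t)" "times_differentiable n (deriv f)"
    by auto
qed

section \<open>Smooth functions that are flat at 0\<close>

text \<open>The classical function \<open>exp (- 1 / t)\<close>, extended by 0, with a polynomial
  factor in \<open>1 / t\<close>. This factor makes the family closed under differentiation.\<close>

definition flat :: "real poly \<Rightarrow> real \<Rightarrow> real" where
  "flat p t = (if t > 0 then poly p (1 / t) * exp (- (1 / t)) else 0)"

lemma poly_over_exp_tendsto_0: "((\<lambda>u::real. poly p u * exp (- u)) \<longlongrightarrow> 0) at_top"
proof -
  have "((\<lambda>u. \<Sum>i\<le>degree p. coeff p i * (u ^ i / exp u)) \<longlongrightarrow> (\<Sum>i\<le>degree p. coeff p i * 0)) at_top"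
    by (intro tendsto_sum tendsto_mult tendsto_const tendsto_power_div_exp_0)
  then show ?thesis
    by (simp add: poly_altdef exp_minus sum_distrib_right divide_inverse mult.assoc)
qed

text \<open>For positive \<open>t\<close>, differentiating \<open>p (1 / t)\<close> gives
  \<open>- p' (1 / t) / t^2\<close> and differentiating the exponential gives a factor
  \<open>1 / t^2\<close>; \<open>[:0, 0, 1:]\<close> is the square of the variable and encodes this
  common factor.\<close>

lemma flat_has_real_derivative:
  "(flat p has_real_derivative flat ([:0, 0, 1:] * (p - pderiv p)) t) (at t)"
proof -
  consider "t > 0" | "t < 0" | "t = 0" by linarith
  then show ?thesis
  proof cases
    case 1
    have "((\<lambda>t. poly p (1 / t) * exp (- (1 / t))) has_real_derivative
        flat ([:0, 0, 1:] * (p - pderiv p)) t) (at t)"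
      unfolding flat_def using 1
      by (auto intro!: derivative_eq_intros DERIV_chain2[OF poly_DERIV]
          simp: field_simps power2_eq_square)
    then show ?thesis
      by (rule has_field_derivative_transform_within_open[of _ _ _ "{0<..}"])
        (use 1 in \<open>auto simp: flat_def\<close>)
  next
    case 2
    have "((\<lambda>_. 0) has_real_derivative flat ([:0, 0, 1:] * (p - pderiv p)) t) (at t)"
      using 2 by (simp add: flat_def)
    then show ?thesis
      by (rule has_field_derivative_transform_within_open[of _ _ _ "{..<0}"])
        (use 2 in \<open>auto simp: flat_def\<close>)
  next
    case 3
    \<comment> \<open>With \<open>u = 1 / t\<close>, the difference quotient at 0 from the right is
      \<open>u * p u * exp (- u)\<close>; the factor \<open>[:0, 1:]\<close> is the extra
      \<open>u\<close>.\<close>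
    have "((\<lambda>t. poly ([:0, 1:] * p) (inverse t) * exp (- inverse t)) \<longlongrightarrow> 0) (at_right (0::real))"
      by (rule filterlim_compose[OF poly_over_exp_tendsto_0 filterlim_inverse_at_top_right])
    then have "((\<lambda>t. flat p t / t) \<longlongrightarrow> 0) (at_right 0)"
      by (rule Lim_transform_eventually)
        (auto simp: eventually_at_filter flat_def field_simps)
    moreover have "((\<lambda>t. flat p t / t) \<longlongrightarrow> 0) (at_left 0)"
      by (rule Lim_transform_eventually[OF tendsto_const])
        (auto simp: eventually_at_filter flat_def)
    ultimately have "((\<lambda>t. flat p t / t) \<longlongrightarrow> 0) (at 0)"
      by (rule filterlim_split_at[rotated])
    then show ?thesis
      by (simp add: 3 has_field_derivative_iff flat_def)
  qed
qed

lemma times_differentiable_flat: "times_differentiable n (flat p)"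
proof (induction n arbitrary: p)
  case (Suc n)
  show ?case
    unfolding times_differentiable.simps
    by (intro exI[of _ "flat ([:0, 0, 1:] * (p - pderiv p))"] conjI allI flat_has_real_derivative Suc)
qed simp

section \<open>Bump functions with uniform derivative bounds\<close>

text \<open>All derivatives are supplied as a sequence \<open>B\<close>, so that partial derivatives
  of product bumps can be written explicitly. Each is bounded by continuity and compact
  support.\<close>

lemma smooth_bump_real:
  obtains B :: "nat \<Rightarrow> real \<Rightarrow> real" where
    "\<And>k t. (B k has_real_derivative B (Suc k) t) (at t)"
    "\<And>k t. \<bar>t\<bar> > 1/2 \<Longrightarrow> B k t = 0"
    "B 0 0 = 1"
    "\<And>K. \<exists>M. \<forall>k\<le>K. \<forall>t. \<bar>B k t\<bar> \<le> M"
proof -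
  \<comment> \<open>The first factor vanishes for \<open>t \<le> -1/2\<close>, the second for
    \<open>t \<ge> 1/2\<close>. Both \<open>flat\<close> values at 0 equal \<open>exp (-2)\<close>,
    so \<open>exp 4\<close> normalises \<open>b 0\<close> to 1.\<close>
  define b where "b = (\<lambda>t. (exp 4 * flat 1 (1/2 + 1 * t)) * (1 * flat 1 (1/2 + (-1) * t)))"
  define B where "B = (\<lambda>k. (deriv ^^ k) b)"
  have "times_differentiable n b" for n
    unfolding b_def
    by (intro times_differentiable_mult times_differentiable_affine times_differentiable_flat)
  then have td: "times_differentiable n (B k)" for n k
    by (induction k arbitrary: n) (auto simp: B_def intro: times_differentiable_deriv(2))
  have der: "(B k has_real_derivative B (Suc k) t) (at t)" for k t
    using times_differentiable_deriv(1)[OF td] by (simp add: B_def)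
  have zero: "B k t = 0" if "\<bar>t\<bar> > 1/2" for k t
    using that
  proof (induction k arbitrary: t)
    case 0
    then show ?case by (auto simp: B_def b_def flat_def)
  next
    case (Suc k)
    have "open {t::real. \<bar>t\<bar> > 1/2}"
      by (intro open_Collect_less continuous_intros)
    then have "((\<lambda>_. 0) has_real_derivative B (Suc k) t) (at t)"
      by (rule has_field_derivative_transform_within_open[OF der]) (use Suc in auto)
    then show ?case using DERIV_unique[OF _ DERIV_const] by blast
  qed
  have bound1: "\<exists>M. \<forall>t. \<bar>B k t\<bar> \<le> M" for k
  proof -
    have "continuous_on {-1/2..1/2} (B k)"
      using der by (intro continuous_at_imp_continuous_on) (blast intro: DERIV_isCont)
    then have "bounded (B k ` {-1/2..1/2})"
      by (intro compact_imp_bounded compact_continuous_image) auto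
    then obtain M where M: "\<And>t. t \<in> {-1/2..1/2} \<Longrightarrow> \<bar>B k t\<bar> \<le> M"
      unfolding bounded_iff by (metis imageI real_norm_def)
    have "\<bar>B k t\<bar> \<le> max M 0" for t
    proof (cases "\<bar>t\<bar> > 1/2")
      case False
      then have "t \<in> {-1/2..1/2}" by auto
      then show ?thesis using M by fastforce
    qed (simp add: zero)
    then show ?thesis by blast
  qed
  then obtain M where M: "\<And>k t. \<bar>B k t\<bar> \<le> M k" by metis
  show ?thesis
  proof (rule that[of B, OF der zero])
    show "B 0 0 = 1" by (simp add: B_def b_def flat_def flip: exp_add)
    show "\<exists>M. \<forall>k\<le>K. \<forall>t. \<bar>B k t\<bar> \<le> M" for K
    proof (intro exI allI impI)
      fix k t assume "k \<le> K"
      have "\<bar>B k t\<bar> \<le> M k" by (rule M)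
      also have "\<dots> \<le> (\<Sum>k\<le>K. M k)"
        using \<open>k \<le> K\<close> by (intro member_le_sum) (auto intro: order_trans[OF abs_ge_zero M])
      finally show "\<bar>B k t\<bar> \<le> (\<Sum>k\<le>K. M k)" .
    qed
  qed
qed

text \<open>A product bump scaled by \<open>r\<close> around \<open>a\<close>: each derivative costs
  a factor \<open>1 / r\<close>, and on the support the norm is at most \<open>1 + norm a\<close>.
  The essential point is that \<open>M\<close> depends on \<open>K\<close> but not on
  \<open>a\<close> or \<open>r\<close>.\<close>

lemma schwartz_bump:
  fixes V :: "(real \<times> real) set"
  shows "\<exists>M>0. \<forall>a r. 0 < r \<and> r \<le> 1 \<and> ball a r \<subseteq> V \<longrightarrow>
    (\<exists>s\<in>schwartz_space_on V. s a = 1 \<and>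
      (\<forall>k bs. k \<le> K \<and> length bs \<le> K \<and> set bs \<subseteq> Basis \<longrightarrow>
        schwartz_seminorm k bs s \<le> M * ((1 + norm a) / r) ^ K))"
proof -
  obtain B :: "nat \<Rightarrow> real \<Rightarrow> real" where
    der: "\<And>k t. (B k has_real_derivative B (Suc k) t) (at t)" and
    zero: "\<And>k t. \<bar>t\<bar> > 1/2 \<Longrightarrow> B k t = 0" and
    one: "B 0 0 = 1" and
    bound: "\<And>K. \<exists>M. \<forall>k\<le>K. \<forall>t. \<bar>B k t\<bar> \<le> M"
    by (rule smooth_bump_real) (rule that)
  obtain M where M: "\<And>k t. k \<le> K \<Longrightarrow> \<bar>B k t\<bar> \<le> M" using bound[of K] by blast
  have M1: "M \<ge> 1" using M[of 0 0] one by simp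
  have "\<exists>s\<in>schwartz_space_on V. s a = 1 \<and>
      (\<forall>k bs. k \<le> K \<and> length bs \<le> K \<and> set bs \<subseteq> Basis \<longrightarrow>
        schwartz_seminorm k bs s \<le> M ^ 2 * ((1 + norm a) / r) ^ K)"
    if r: "0 < r" "r \<le> 1" and V: "ball a r \<subseteq> V" for a r
  proof -
    \<comment> \<open>The mixed derivative of orders \<open>i\<close> and \<open>j\<close> of the
      scaled product bump, up to a power of \<open>r\<close>; \<open>F 0 0\<close> is the bump
      itself.\<close>
    define F where "F = (\<lambda>i j x. B i ((fst x - fst a) / r) * B j ((snd x - snd a) / r))"
    have F_der: "(F i j has_derivative
       (\<lambda>h. (F (Suc i) j x * fst h + F i (Suc j) x * snd h) / r)) (at x)" for i j x
    proof -
      have "((\<lambda>x. (fst x - fst a) / r) has_derivative (\<lambda>h. fst h / r)) (at x)"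
        "((\<lambda>x. (snd x - snd a) / r) has_derivative (\<lambda>h. snd h / r)) (at x)"
        using r by (auto intro!: derivative_eq_intros)
      from this[THEN has_derivative_compose[OF _ der[unfolded has_field_derivative_def]]]
      have "((\<lambda>x. B i ((fst x - fst a) / r)) has_derivative
          (\<lambda>h. B (Suc i) ((fst x - fst a) / r) * (fst h / r))) (at x)"
        "((\<lambda>x. B j ((snd x - snd a) / r)) has_derivative
          (\<lambda>h. B (Suc j) ((snd x - snd a) / r) * (snd h / r))) (at x)"
        by blast+
      from has_derivative_mult[OF this] show ?thesis
        unfolding F_def by (rule has_derivative_eq_rhs) (auto simp: fun_eq_iff algebra_simps add_divide_distrib)
    qed
    have F_div_der: "((\<lambda>x. F i j x / c) has_derivative
       (\<lambda>h. (F (Suc i) j x * fst h + F i (Suc j) x * snd h) / r / c)) (at x)" for i j c x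
      by (rule bounded_linear.has_derivative[OF bounded_linear_divide F_der])
    have F_zero: "F i j x = 0" if "x \<notin> ball a r" for i j x
    \<comment> \<open>The support is contained in a square of side \<open>r\<close> centred at
      \<open>a\<close>, whose points have distance at most \<open>r / sqrt 2 < r\<close> from
      \<open>a\<close>.\<close>
    proof (rule ccontr)
      assume nz: "F i j x \<noteq> 0"
      then have "\<bar>(fst x - fst a) / r\<bar> \<le> 1/2" "\<bar>(snd x - snd a) / r\<bar> \<le> 1/2"
        using zero unfolding F_def by (metis mult_eq_0_iff not_le)+
      then have "\<bar>fst x - fst a\<bar> \<le> \<bar>r / 2\<bar>" "\<bar>snd x - snd a\<bar> \<le> \<bar>r / 2\<bar>"
        using r by (auto simp: abs_div field_simps)
      then have "(fst x - fst a)\<^sup>2 \<le> (r/2)\<^sup>2" "(snd x - snd a)\<^sup>2 \<le> (r/2)\<^sup>2"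
        by (simp_all only: abs_le_square_iff)
      then have "(fst x - fst a)\<^sup>2 + (snd x - snd a)\<^sup>2 \<le> r\<^sup>2 / 2"
        by (simp add: power_divide)
      also have "\<dots> < r\<^sup>2" using r by simp
      finally have "sqrt ((fst x - fst a)\<^sup>2 + (snd x - snd a)\<^sup>2) < r"
        using r by (simp add: real_less_lsqrt)
      then have "dist a x < r"
        by (simp add: dist_prod_def dist_real_def power2_commute)
      then show False using that by simp
    qed
    have partial: "\<exists>i j. i \<le> length bs \<and> j \<le> length bs \<and>
       iterated_partial bs (F 0 0) = (\<lambda>x. F i j x / r ^ length bs)"
      if "set bs \<subseteq> Basis" for bs
      using that
    proof (induction bs)
      case Nil
      then show ?case by auto
    next
      case (Cons b bs)
      then obtain i j where ij: "i \<le> length bs" "j \<le> length bs"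
        "iterated_partial bs (F 0 0) = (\<lambda>x. F i j x / r ^ length bs)"
        by auto
      have "iterated_partial (b # bs) (F 0 0) =
          (\<lambda>x. (F (Suc i) j x * fst b + F i (Suc j) x * snd b) / r / r ^ length bs)"
      proof
        fix x
        have "((\<lambda>x. F i j x / r ^ length bs) has_derivative
          (\<lambda>h. (F (Suc i) j x * fst h + F i (Suc j) x * snd h) / r / r ^ length bs)) (at x)"
          by (rule F_div_der)
        from partial_derivative_eq[OF this]
        show "iterated_partial (b # bs) (F 0 0) x =
          (F (Suc i) j x * fst b + F i (Suc j) x * snd b) / r / r ^ length bs"
          by (simp add: ij(3))
      qed
      \<comment> \<open>For a coordinate direction one of the two summands disappears, so the
        iterated partial is again a single \<open>F\<close> divided by a power of
        \<open>r\<close>.\<close>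
      moreover have "b = (1, 0) \<or> b = (0, 1)"
        using Cons.prems by (auto simp: Basis_prod_def)
      ultimately have "iterated_partial (b # bs) (F 0 0) = (\<lambda>x. F (Suc i) j x / r ^ length (b # bs)) \<or>
          iterated_partial (b # bs) (F 0 0) = (\<lambda>x. F i (Suc j) x / r ^ length (b # bs))"
        by auto
      then show ?case
      proof
        assume "iterated_partial (b # bs) (F 0 0) = (\<lambda>x. F (Suc i) j x / r ^ length (b # bs))"
        then show ?thesis using ij(1,2) by (intro exI[of _ "Suc i"] exI[of _ j]) simp
      next
        assume "iterated_partial (b # bs) (F 0 0) = (\<lambda>x. F i (Suc j) x / r ^ length (b # bs))"
        then show ?thesis using ij(1,2) by (intro exI[of _ i] exI[of _ "Suc j"]) simp
      qed
    qed
    have partial_zero: "iterated_partial bs (F 0 0) x = 0" if "set bs \<subseteq> Basis" "x \<notin> ball a r" for bs x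
      using partial[OF that(1)] F_zero[OF that(2)] by auto
    \<comment> \<open>The bound is kept general in \<open>L\<close> and \<open>N\<close> for two
      uses: arbitrary orders, to see that the bump is a Schwartz function, and the fixed order
      \<open>K\<close> with the uniform bound \<open>M\<close>.\<close>
    have partial_bound: "norm x ^ k * \<bar>iterated_partial bs (F 0 0) x\<bar> \<le>
        N ^ 2 * ((1 + norm a) / r) ^ L"
      if L: "k \<le> L" "length bs \<le> L" and bs: "set bs \<subseteq> Basis"
        and N: "\<And>k t. k \<le> L \<Longrightarrow> \<bar>B k t\<bar> \<le> N" for k bs x N L
    proof (cases "x \<in> ball a r")
      case False
      have "N \<ge> 0" using N[of 0 0] by simp
      then show ?thesis using partial_zero[OF bs False] r by simp
    next
      case True
      obtain i j where ij: "i \<le> length bs" "j \<le> length bs"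
        "iterated_partial bs (F 0 0) = (\<lambda>x. F i j x / r ^ length bs)"
        using partial[OF bs] by blast
      have "norm x \<le> 1 + norm a"
        using True r norm_triangle_ineq2[of x a] by (simp add: dist_norm norm_minus_commute)
      then have "norm x ^ k \<le> (1 + norm a) ^ k"
        by (intro power_mono) auto
      also have "\<dots> \<le> (1 + norm a) ^ L"
        using L(1) by (intro power_increasing) auto
      finally have 1: "norm x ^ k \<le> (1 + norm a) ^ L" .
      have "\<bar>F i j x\<bar> \<le> N * N"
        unfolding F_def abs_mult using N ij L by (intro mult_mono) (auto intro: order_trans[OF abs_ge_zero])
      then have "\<bar>iterated_partial bs (F 0 0) x\<bar> \<le> N * N / r ^ length bs"
        using r by (simp add: ij(3) divide_right_mono)
      also have "\<dots> \<le> N * N / r ^ L"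
        using r L(2) by (intro divide_left_mono power_decreasing mult_pos_pos) auto
      finally have "norm x ^ k * \<bar>iterated_partial bs (F 0 0) x\<bar> \<le> (1 + norm a) ^ L * (N * N / r ^ L)"
        by (intro mult_mono 1) auto
      then show ?thesis by (simp add: power_divide power2_eq_square mult_ac)
    qed
    have smooth: "smooth_on UNIV (F 0 0)"
      unfolding smooth_on_def
    proof (intro allI impI)
      fix bs :: "(real \<times> real) list" assume "set bs \<subseteq> Basis"
      then obtain i j where "iterated_partial bs (F 0 0) = (\<lambda>x. F i j x / r ^ length bs)"
        using partial by blast
      moreover have "(\<lambda>x. F i j x / r ^ length bs) differentiable_on UNIV"
        unfolding differentiable_on_def differentiable_def
        using F_div_der by blast
      ultimately show "iterated_partial bs (F 0 0) differentiable_on UNIV" by simp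
    qed
    have "F 0 0 \<in> schwartz_functions"
    proof (rule schwartz_functionsI[OF smooth])
      fix k and bs :: "(real \<times> real) list" assume bs: "set bs \<subseteq> Basis"
      obtain N where "\<And>k' t. k' \<le> max k (length bs) \<Longrightarrow> \<bar>B k' t\<bar> \<le> N" using bound by blast
      then show "\<exists>C. \<forall>x. norm x ^ k * \<bar>iterated_partial bs (F 0 0) x\<bar> \<le> C"
        using partial_bound[OF max.cobounded1 max.cobounded2 bs] by blast
    qed
    then have "F 0 0 \<in> schwartz_space_on V"
      using partial_zero V unfolding schwartz_space_on_def by blast
    moreover have "F 0 0 a = 1" by (simp add: F_def one)
    moreover have "schwartz_seminorm k bs (F 0 0) \<le> M ^ 2 * ((1 + norm a) / r) ^ K"
      if "k \<le> K \<and> length bs \<le> K \<and> set bs \<subseteq> Basis" for k bs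
      using that partial_bound M by (intro schwartz_seminorm_least) blast
    ultimately show ?thesis by blast
  qed
  moreover have "M ^ 2 > 0" using M1 by simp
  ultimately show ?thesis by blast
qed

section \<open>Distance to the boundary under continuous pullbacks\<close>

text \<open>For the bump \<open>s\<close> at \<open>\<phi> x\<close>, the image \<open>T s\<close>
  is 1 at \<open>x\<close> and 0 at \<open>z\<close>, and the Lipschitz bound compares this with the
  seminorms of \<open>s\<close>. \<open>T\<close> is abstract so that the estimate serves both the
  pullback and its inverse.\<close>

lemma pullback_boundary_estimate:
  fixes U V :: "(real \<times> real) set"
  assumes cont: "continuous_map (schwartz_topology_on V) (schwartz_topology_on U) T"
    and scale: "\<And>c s. s \<in> schwartz_space_on V \<Longrightarrow> T (\<lambda>y. c * s y) = (\<lambda>x. c * T s x)"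
    and pull: "\<And>s x. \<lbrakk>s \<in> schwartz_space_on V; x \<in> U\<rbrakk> \<Longrightarrow> T s x = s (\<phi> x)"
  obtains C N where "C > 0"
    "\<And>x z r. \<lbrakk>x \<in> U; z \<notin> U; 0 < r; r \<le> 1; ball (\<phi> x) r \<subseteq> V\<rbrakk> \<Longrightarrow>
       1 \<le> C * dist x z * ((1 + norm (\<phi> x)) / r) ^ N"
proof -
  have "\<exists>K C. C > 0 \<and> (\<forall>s A. s \<in> schwartz_space_on V \<and> A > 0 \<and>
      (\<forall>k bs. k \<le> K \<and> length bs \<le> K \<and> set bs \<subseteq> Basis \<longrightarrow> schwartz_seminorm k bs s \<le> A) \<longrightarrow>
      schwartz_seminorm 0 [b] (T s) \<le> C * A)" if b: "b \<in> Basis" for b :: "real \<times> real"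
  proof -
    from b have "set [b] \<subseteq> Basis" by simp
    from seminorm_bound_if_continuous[OF cont scale this, of 0] obtain C K where "C > 0"
      "\<And>s A. \<lbrakk>s \<in> schwartz_space_on V; A > 0;
        \<And>k bs. \<lbrakk>k \<le> K; length bs \<le> K; set bs \<subseteq> Basis\<rbrakk> \<Longrightarrow> schwartz_seminorm k bs s \<le> A\<rbrakk> \<Longrightarrow>
      schwartz_seminorm 0 [b] (T s) \<le> C * A"
      by metis
    then show ?thesis
      by (intro exI[of _ K] exI[of _ C] conjI allI impI) (assumption, simp)
  qed
  then obtain K :: "real \<times> real \<Rightarrow> nat" and C :: "real \<times> real \<Rightarrow> real" where
    C: "\<And>b. b \<in> Basis \<Longrightarrow> C b > 0" and
    K: "\<And>b s A. \<lbrakk>b \<in> Basis; s \<in> schwartz_space_on V \<and> A > 0 \<and>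
      (\<forall>k bs. k \<le> K b \<and> length bs \<le> K b \<and> set bs \<subseteq> Basis \<longrightarrow> schwartz_seminorm k bs s \<le> A)\<rbrakk> \<Longrightarrow>
      schwartz_seminorm 0 [b] (T s) \<le> C b * A"
    by metis
  \<comment> \<open>A convenient number dominating \<open>K b\<close> for all coordinate directions
    \<open>b\<close>.\<close>
  define N where "N = (\<Sum>b\<in>Basis. K b)"
  obtain M where M: "M > 0"
    "\<forall>a r. 0 < r \<and> r \<le> 1 \<and> ball a r \<subseteq> V \<longrightarrow>
    (\<exists>s\<in>schwartz_space_on V. s a = 1 \<and>
      (\<forall>k bs. k \<le> N \<and> length bs \<le> N \<and> set bs \<subseteq> Basis \<longrightarrow>
        schwartz_seminorm k bs s \<le> M * ((1 + norm a) / r) ^ N))"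
    using schwartz_bump[where V = V and K = N] by (elim exE conjE)
  show ?thesis
  proof (rule that[of "(\<Sum>b\<in>Basis. C b) * M" N])
    show "(\<Sum>b\<in>Basis. C b) * M > 0"
      using M(1) C by (intro mult_pos_pos sum_pos) auto
  next
    fix x z r assume x: "x \<in> U" and z: "z \<notin> U" and r: "0 < r" "r \<le> 1" "ball (\<phi> x) r \<subseteq> V"
    define A where "A = M * ((1 + norm (\<phi> x)) / r) ^ N"
    have A: "A > 0"
      unfolding A_def using M(1) r by (intro mult_pos_pos zero_less_power divide_pos_pos add_pos_nonneg) auto
    obtain s where s: "s \<in> schwartz_space_on V" "s (\<phi> x) = 1"
      "\<forall>k bs. k \<le> N \<and> length bs \<le> N \<and> set bs \<subseteq> Basis \<longrightarrow> schwartz_seminorm k bs s \<le> A"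
      using M(2) r unfolding A_def by blast
    have Ts: "T s \<in> schwartz_space_on U"
      using continuous_map_image_subset_topspace[OF cont] s(1)
      by (auto simp: topspace_schwartz_topology_on)
    then have "\<forall>bs. set bs \<subseteq> Basis \<longrightarrow> (\<forall>x. x \<notin> U \<longrightarrow> iterated_partial bs (T s) x = 0)"
      and TsS: "T s \<in> schwartz_functions"
      unfolding schwartz_space_on_def by blast+
    from this(1)[rule_format, of "[]" z] have "T s z = 0"
      using z by simp
    moreover have "T s x = 1" using pull[OF s(1) x] s(2) by simp
    ultimately have "1 \<le> dist x z * (\<Sum>b\<in>Basis. schwartz_seminorm 0 [b] (T s))"
      using lipschitz_bound_by_seminorms[OF TsS, of x z] by simp
    also have "\<dots> \<le> dist x z * (\<Sum>b\<in>Basis. C b * A)"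
    proof (intro mult_left_mono sum_mono)
      fix b :: "real \<times> real" assume b: "b \<in> Basis"
      then have "K b \<le> N" unfolding N_def by (intro member_le_sum) auto
      then show "schwartz_seminorm 0 [b] (T s) \<le> C b * A"
        using s A by (intro K[OF b]) (meson order_trans)
    qed simp
    also have "\<dots> = (\<Sum>b\<in>Basis. C b) * M * dist x z * ((1 + norm (\<phi> x)) / r) ^ N"
      unfolding sum_distrib_right[symmetric] by (simp add: A_def)
    finally show "1 \<le> (\<Sum>b\<in>Basis. C b) * M * dist x z * ((1 + norm (\<phi> x)) / r) ^ N" .
  qed
qed

section \<open>Riemann maps as smooth diffeomorphisms\<close>

lemma linear_to_of_complex:
  "linear (\<lambda>p::real\<times>real. Complex (fst p) (snd p))" "linear (\<lambda>z. (Re z, Im z))"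
  by (auto intro!: linearI simp: complex_eq_iff)

lemma bounded_linear_to_complex: "bounded_linear (\<lambda>p::real\<times>real. Complex (fst p) (snd p))"
  and bounded_linear_from_complex: "bounded_linear (\<lambda>z. (Re z, Im z))"
  by (auto intro!: linear_to_of_complex linear_conv_bounded_linear[THEN iffD1])

abbreviation to_complex :: "real \<times> real \<Rightarrow> complex" where
  "to_complex p \<equiv> Complex (fst p) (snd p)"

abbreviation of_complex :: "complex \<Rightarrow> real \<times> real" where
  "of_complex z \<equiv> (Re z, Im z)"

lemma has_derivative_holomorphic_plane:
  assumes "f holomorphic_on S" "open S" "to_complex p \<in> S"
  shows "((\<lambda>p. of_complex (f (to_complex p))) has_derivative
          (\<lambda>h. of_complex (deriv f (to_complex p) * to_complex h))) (at p)"
proof -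
  have "(f has_derivative (\<lambda>h. deriv f (to_complex p) * h)) (at (to_complex p))"
    using holomorphic_derivI[OF assms(1,2,3)] by (simp add: has_field_derivative_def)
  from has_derivative_compose[OF bounded_linear_imp_has_derivative[OF bounded_linear_to_complex] this]
  have "((\<lambda>p. f (to_complex p)) has_derivative (\<lambda>h. deriv f (to_complex p) * to_complex h)) (at p)" .
  from bounded_linear.has_derivative[OF bounded_linear_from_complex this]
  show ?thesis .
qed

text \<open>A partial derivative in direction \<open>b\<close> multiplies the complex derivative by
  the constant \<open>to_complex b\<close>, so it is again holomorphic in complex coordinates, and
  the induction continues.\<close>

lemma iterated_partial_holomorphic:
  assumes "f holomorphic_on S" "open S"
  shows "\<exists>g. g holomorphic_on S \<and> (\<forall>p. to_complex p \<in> S \<longrightarrow>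
     iterated_partial bs (\<lambda>p. of_complex (f (to_complex p))) p = of_complex (g (to_complex p)))"
proof (induction bs)
  case Nil
  then show ?case using assms(1) by (auto intro!: exI[of _ f])
next
  case (Cons b bs)
  then obtain g where g: "g holomorphic_on S" "\<And>p. to_complex p \<in> S \<Longrightarrow>
     iterated_partial bs (\<lambda>p. of_complex (f (to_complex p))) p = of_complex (g (to_complex p))"
    by blast
  have op: "open {p. to_complex p \<in> S}"
    using open_vimage[OF assms(2) linear_continuous_on[OF bounded_linear_to_complex]]
    by (simp add: vimage_def)
  show ?case
  proof (intro exI[of _ "\<lambda>z. deriv g z * to_complex b"] conjI allI impI)
    fix p assume p: "to_complex p \<in> S"
    have "iterated_partial (b # bs) (\<lambda>p. of_complex (f (to_complex p))) p =
        partial_derivative b (\<lambda>p. of_complex (g (to_complex p))) p"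
      unfolding iterated_partial.simps
      by (rule partial_derivative_cong[OF op]) (use p g(2) in auto)
    then show "iterated_partial (b # bs) (\<lambda>p. of_complex (f (to_complex p))) p =
        of_complex (deriv g (to_complex p) * to_complex b)"
      using partial_derivative_eq[OF has_derivative_holomorphic_plane[OF g(1) assms(2) p]] by simp
  qed (intro holomorphic_intros holomorphic_deriv g(1) assms(2))
qed

lemma smooth_on_holomorphic:
  assumes "f holomorphic_on S" "open S"
  shows "smooth_on {p. to_complex p \<in> S} (\<lambda>p. of_complex (f (to_complex p)))"
  unfolding smooth_on_def
proof (intro allI impI)
  fix bs :: "(real \<times> real) list"
  obtain g where g: "g holomorphic_on S" "\<And>p. to_complex p \<in> S \<Longrightarrow>
     iterated_partial bs (\<lambda>p. of_complex (f (to_complex p))) p = of_complex (g (to_complex p))"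
    using iterated_partial_holomorphic[OF assms] by blast
  have "(\<lambda>p. of_complex (g (to_complex p))) differentiable_on {p. to_complex p \<in> S}"
    unfolding differentiable_on_def differentiable_def
    using has_derivative_at_withinI[OF has_derivative_holomorphic_plane[OF g(1) assms(2)]]
    by blast
  then show "iterated_partial bs (\<lambda>p. of_complex (f (to_complex p)))
      differentiable_on {p. to_complex p \<in> S}"
    by (rule differentiable_on_transform) (simp add: g(2))
qed

text \<open>The Riemann mapping theorem supplies a biholomorphic map; both it and its inverse are
  holomorphic and hence smooth in real coordinates.\<close>

lemma simply_connected_smoothly_diffeomorphic_disc:
  fixes G :: "(real \<times> real) set"
  assumes "open G" "G \<noteq> {}" "G \<noteq> UNIV" "simply_connected G"
  shows "smoothly_diffeomorphic G unit_disc"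
proof -
  define S where "S = to_complex ` G"
  have oc [simp]: "of_complex (to_complex p) = p" "to_complex (of_complex z) = z" for p z
    by (auto simp: complex_eq_iff)
  have mem: "to_complex p \<in> S \<longleftrightarrow> p \<in> G" for p
    by (cases p) (force simp: S_def image_iff)
  have S: "S = {z. of_complex z \<in> G}"
    using mem[of "of_complex z" for z] by auto
  have "homeomorphism G S to_complex of_complex"
  proof (rule homeomorphismI)
    show "continuous_on G to_complex" "continuous_on S of_complex"
      by (intro linear_continuous_on bounded_linear_to_complex bounded_linear_from_complex)+
  qed (auto simp: mem S)
  then have sc: "simply_connected S"
    using assms(4) homeomorphic_simply_connected homeomorphic_def by blast
  have "open S"
    using open_vimage[OF assms(1) linear_continuous_on[OF bounded_linear_from_complex]]
    by (simp add: vimage_def S)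
  moreover have "S \<noteq> {}" "S \<noteq> UNIV"
    using assms(2,3) mem by blast+
  ultimately obtain f g where fg: "f holomorphic_on S" "g holomorphic_on ball 0 1"
     "\<And>z. z \<in> S \<Longrightarrow> f z \<in> ball 0 1 \<and> g (f z) = z"
     "\<And>z. z \<in> ball 0 1 \<Longrightarrow> g z \<in> S \<and> f (g z) = z"
    using sc Riemann_mapping_theorem[of S] by blast
  define \<phi> where "\<phi> = (\<lambda>p. of_complex (f (to_complex p)))"
  define \<psi> where "\<psi> = (\<lambda>p. of_complex (g (to_complex p)))"
  have disc: "to_complex p \<in> ball 0 1 \<longleftrightarrow> p \<in> unit_disc" for p
    by (cases p) (simp add: cmod_def dist_Pair_Pair)
  have 1: "\<phi> p \<in> unit_disc" "\<psi> (\<phi> p) = p" if "p \<in> G" for p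
  proof -
    have "to_complex p \<in> S" using that mem by blast
    from fg(3)[OF this] have *: "f (to_complex p) \<in> ball 0 1" "g (f (to_complex p)) = to_complex p"
      by blast+
    show "\<phi> p \<in> unit_disc"
      using *(1) disc[of "\<phi> p"] unfolding \<phi>_def oc by blast
    show "\<psi> (\<phi> p) = p"
      using *(2) unfolding \<phi>_def \<psi>_def oc by (simp only: oc)
  qed
  have 2: "\<psi> p \<in> G" "\<phi> (\<psi> p) = p" if "p \<in> unit_disc" for p
  proof -
    have "to_complex p \<in> ball 0 1" using that disc by blast
    from fg(4)[OF this] have *: "g (to_complex p) \<in> S" "f (g (to_complex p)) = to_complex p"
      by blast+
    show "\<psi> p \<in> G"
      using *(1) mem[of "\<psi> p"] unfolding \<psi>_def oc by blast
    show "\<phi> (\<psi> p) = p"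
      using *(2) unfolding \<phi>_def \<psi>_def oc by (simp only: oc)
  qed
  have bij: "bij_betw \<phi> G unit_disc"
    by (rule bij_betw_byWitness[where f' = \<psi>]) (use 1 2 in auto)
  \<comment> \<open>The agreement holds only on the disc, which suffices because smoothness on an
    open set is local.\<close>
  have inv: "\<psi> p = inv_into G \<phi> p" if "p \<in> unit_disc" for p
    using bij 2[OF that] by (metis bij_betw_def inv_into_f_f)
  have "smooth_on unit_disc \<psi>"
    using smooth_on_holomorphic[OF fg(2) open_ball] unfolding disc \<psi>_def Collect_mem_eq .
  then have "smooth_on unit_disc (inv_into G \<phi>)"
    by (rule smooth_on_cong[OF open_ball, rotated]) (rule inv)
  moreover have "smooth_on G \<phi>"
    using smooth_on_holomorphic[OF fg(1) \<open>open S\<close>] unfolding mem \<phi>_def Collect_mem_eq .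
  ultimately show ?thesis
    using bij unfolding smoothly_diffeomorphic_def smooth_diffeomorphism_def by blast
qed

section \<open>The domain with thin necks\<close>

lemma G_domain_iff:
  "(x, y) \<in> G_domain \<longleftrightarrow> (\<exists>n\<ge>1. (x - real n)\<^sup>2 + y\<^sup>2 < (1 / real n ^ 2)\<^sup>2 \<or>
     real n < x \<and> x < real n + 1 \<and> \<bar>y\<bar> < (1/2) * exp (- exp (real n ^ 2)))"
proof -
  have "(x, y) \<in> ball (real n, 0) (1 / real n ^ 2) \<longleftrightarrow> (x - real n)\<^sup>2 + y\<^sup>2 < (1 / real n ^ 2)\<^sup>2" for n
  proof -
    have "sqrt ((x - real n)\<^sup>2 + y\<^sup>2) < 1 / real n ^ 2 \<longleftrightarrow> (x - real n)\<^sup>2 + y\<^sup>2 < (1 / real n ^ 2)\<^sup>2"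
      using real_sqrt_less_iff[of "(x - real n)\<^sup>2 + y\<^sup>2" "(1 / real n ^ 2)\<^sup>2"] by simp
    then show ?thesis by (simp add: dist_Pair_Pair dist_real_def power2_commute)
  qed
  then show ?thesis
    unfolding G_domain_def by (fastforce simp: abs_less_iff)
qed

lemma open_G_domain: "open G_domain"
  unfolding G_domain_def by (intro open_UN ballI open_Un open_ball open_Times open_greaterThanLessThan)

text \<open>Each disc is centred on the axis and each strip is symmetric about it, so the vertical
  sections of each piece are intervals symmetric about 0.\<close>

lemma G_domain_shrink:
  assumes "(x, y) \<in> G_domain" "\<bar>t\<bar> \<le> \<bar>y\<bar>"
  shows "(x, t) \<in> G_domain"
proof -
  have "t\<^sup>2 \<le> y\<^sup>2" using assms(2) by (simp add: abs_le_square_iff)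
  moreover obtain n where "n \<ge> 1" "(x - real n)\<^sup>2 + y\<^sup>2 < (1 / real n ^ 2)\<^sup>2 \<or>
     real n < x \<and> x < real n + 1 \<and> \<bar>y\<bar> < (1/2) * exp (- exp (real n ^ 2))"
    using assms(1) unfolding G_domain_iff by blast
  ultimately show ?thesis
    using assms(2) unfolding G_domain_iff by (intro exI[of _ n]) linarith
qed

text \<open>The disc around 1 has radius 1 and covers the axis from 0 to 1; further right, integers
  are centres of discs and the remaining points lie in strips. Nothing reaches 0, since
  \<open>1 / n^2 \<le> 1 \<le> n\<close>.\<close>

lemma G_domain_axis: "(x, 0) \<in> G_domain \<longleftrightarrow> x > 0"
proof
  assume "(x, 0) \<in> G_domain"
  then obtain n where n: "n \<ge> 1" "(x - real n)\<^sup>2 < (1 / real n ^ 2)\<^sup>2 \<or> real n < x"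
    unfolding G_domain_iff by auto
  have "1 / real n ^ 2 \<le> 1" using n(1) by simp
  moreover have "real n \<ge> 1" using n(1) by simp
  moreover have "\<bar>x - real n\<bar> < 1 / real n ^ 2" if "(x - real n)\<^sup>2 < (1 / real n ^ 2)\<^sup>2"
    using that abs_le_square_iff[of "1 / real n ^ 2" "x - real n"] by force
  ultimately show "x > 0" using n(2) by linarith
next
  assume x: "x > 0"
  show "(x, 0) \<in> G_domain"
  proof (cases "x \<le> 1")
    case True
    then have "\<bar>x - 1\<bar> < 1" using x by simp
    then have "(x - 1)\<^sup>2 < 1" using abs_square_less_1 by blast
    then show ?thesis unfolding G_domain_iff by (intro exI[of _ 1]) simp
  next
    case False
    define n where "n = nat \<lfloor>x\<rfloor>"
    have n: "n \<ge> 1" "real n \<le> x" "x < real n + 1"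
      using False unfolding n_def by linarith+
    show ?thesis
    proof (cases "x = real n")
      case True
      then show ?thesis using n unfolding G_domain_iff by (intro exI[of _ n]) simp
    next
      case False
      then show ?thesis using n unfolding G_domain_iff by (intro exI[of _ n]) simp
    qed
  qed
qed

text \<open>Two straight-line homotopies: vertically onto the axis, then along the axis to
  \<open>(1, 0)\<close>.\<close>

lemma contractible_G_domain: "contractible G_domain"
proof -
  have "homotopic_with_canon (\<lambda>_. True) G_domain G_domain id (\<lambda>p. (fst p, 0))"
  proof (rule homotopic_with_linear)
    fix p assume p: "p \<in> G_domain"
    show "closed_segment (id p) (fst p, 0) \<subseteq> G_domain"
    proof
      fix q assume "q \<in> closed_segment (id p) (fst p, 0)"
      then obtain u where u: "0 \<le> u" "u \<le> 1" "q = (1 - u) *\<^sub>R p + u *\<^sub>R (fst p, 0)"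
        by (auto simp: closed_segment_def)
      obtain x y where xy: "p = (x, y)" by (cases p)
      have "q = (x, (1 - u) * y)" using u xy by (simp add: algebra_simps)
      moreover have "\<bar>(1 - u) * y\<bar> \<le> \<bar>y\<bar>"
        using u by (simp add: abs_mult mult_left_le_one_le)
      ultimately show "q \<in> G_domain" using p xy G_domain_shrink by blast
    qed
  qed (auto intro!: continuous_intros)
  moreover have "homotopic_with_canon (\<lambda>_. True) G_domain G_domain (\<lambda>p. (fst p, 0)) (\<lambda>_. (1, 0))"
  proof (rule homotopic_with_linear)
    fix p assume p: "p \<in> G_domain"
    then have "(fst p, 0) \<in> G_domain"
      using G_domain_shrink[of "fst p" "snd p" 0] by simp
    then have pos: "fst p > 0" by (simp add: G_domain_axis)
    show "closed_segment (fst p, 0) (1, 0) \<subseteq> G_domain"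
    proof
      fix q assume "q \<in> closed_segment (fst p, 0) (1, 0::real)"
      then obtain u where u: "0 \<le> u" "u \<le> 1" "q = (1 - u) *\<^sub>R (fst p, 0) + u *\<^sub>R (1, 0)"
        by (auto simp: closed_segment_def)
      then have "q = ((1 - u) * fst p + u * 1, 0)" by simp
      moreover have "(1 - u) * fst p + u * 1 > 0"
        using u pos by (cases "u = 1") (auto intro!: add_pos_nonneg)
      ultimately show "q \<in> G_domain" by (simp add: G_domain_axis)
    qed
  qed (auto intro!: continuous_intros)
  ultimately show ?thesis
    unfolding contractible_def by (metis homotopic_with_trans)
qed

text \<open>The abscissa is the midpoint of strip \<open>n - 1\<close> and has distance at least 1/2
  from every integer, while discs with \<open>m \<ge> 2\<close> have radius at most 1/4. The disc
  around 1 has radius 1 and is avoided because \<open>n \<ge> 3\<close>.\<close>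

lemma G_domain_neck:
  assumes "n \<ge> 3" "(real n - 1/2, t) \<in> G_domain"
  shows "\<bar>t\<bar> < (1/2) * exp (- exp ((real n - 1) ^ 2))"
proof -
  obtain m where m: "m \<ge> 1" "(real n - 1/2 - real m)\<^sup>2 + t\<^sup>2 < (1 / real m ^ 2)\<^sup>2 \<or>
     real m < real n - 1/2 \<and> real n - 1/2 < real m + 1 \<and> \<bar>t\<bar> < (1/2) * exp (- exp (real m ^ 2))"
    using assms(2) unfolding G_domain_iff by blast
  have "\<not> (real n - 1/2 - real m)\<^sup>2 + t\<^sup>2 < (1 / real m ^ 2)\<^sup>2"
  proof -
    have "1 / real m ^ 2 \<le> \<bar>real n - 1/2 - real m\<bar>"
    proof (cases "m = 1")
      case False
      then have "real m \<ge> 2" using m(1) by linarith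
      then have "real m ^ 2 \<ge> 2 ^ 2" by (intro power_mono) auto
      then have "1 / real m ^ 2 \<le> 1/2" using frac_le[of 1 1 "2 ^ 2" "real m ^ 2"] by simp
      moreover have "\<bar>real n - 1/2 - real m\<bar> \<ge> 1/2"
        by (cases "m \<ge> n") (auto simp: not_le dest!: Suc_leI)
      ultimately show ?thesis by linarith
    qed (use assms(1) in auto)
    then have "(1 / real m ^ 2)\<^sup>2 \<le> (real n - 1/2 - real m)\<^sup>2"
      using abs_le_square_iff[of "1 / real m ^ 2"] by simp
    then show ?thesis by (smt (verit) zero_le_power2)
  qed
  with m(2) have *: "real m < real n - 1/2" "real n - 1/2 < real m + 1"
    "\<bar>t\<bar> < (1/2) * exp (- exp (real m ^ 2))" by blast+
  then have "n = Suc m" by linarith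
  then have "real m = real n - 1" by simp
  with *(3) show ?thesis by simp
qed

section \<open>Failure of Schwartz equivalence\<close>

text \<open>From \<open>n - 1 \<le> (n - 1)^2 \<le> exp ((n - 1)^2)\<close> the double exponential
  is at most \<open>exp 2 * exp (- (1 + n))\<close>, and already a single exponential defeats the
  polynomial.\<close>

lemma not_bounded_below_poly_times_double_exp:
  "\<not> (\<forall>n\<ge>3. 1 \<le> c * (1 + real n) ^ L * exp (- exp ((real n - 1) ^ 2)))"
proof
  assume *: "\<forall>n\<ge>3. 1 \<le> c * (1 + real n) ^ L * exp (- exp ((real n - 1) ^ 2))"
  have "filterlim (\<lambda>n. 1 + real n) at_top sequentially"
    by (intro filterlim_tendsto_add_at_top[OF tendsto_const] filterlim_real_sequentially)
  from filterlim_compose[OF tendsto_power_div_exp_0[of L] this]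
  have "(\<lambda>n. \<bar>c\<bar> * exp 2 * ((1 + real n) ^ L / exp (1 + real n))) \<longlonglongrightarrow> \<bar>c\<bar> * exp 2 * 0"
    by (intro tendsto_mult tendsto_const)
  then have "eventually (\<lambda>n. \<bar>c\<bar> * exp 2 * ((1 + real n) ^ L / exp (1 + real n)) < 1) sequentially"
    by (intro order_tendstoD(2)) auto
  then obtain n where n: "n \<ge> 3" "\<bar>c\<bar> * exp 2 * ((1 + real n) ^ L / exp (1 + real n)) < 1"
    using eventually_happens'[OF _ eventually_conj[OF _ eventually_ge_at_top[of 3]]] by force
  have "real n - 1 \<le> (real n - 1) * (real n - 1)"
    using n(1) mult_left_mono[of 1 "real n - 1" "real n - 1"] by simp
  also have "\<dots> \<le> exp ((real n - 1) ^ 2)"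
    using exp_ge_add_one_self[of "(real n - 1) ^ 2"] unfolding power2_eq_square by linarith
  finally have "exp (- exp ((real n - 1) ^ 2)) \<le> exp (2 - (1 + real n))" by simp
  then have "\<bar>c\<bar> * (1 + real n) ^ L * exp (- exp ((real n - 1) ^ 2)) \<le>
      \<bar>c\<bar> * (1 + real n) ^ L * exp (2 - (1 + real n))"
    by (intro mult_left_mono) auto
  also have "\<dots> = \<bar>c\<bar> * exp 2 * ((1 + real n) ^ L / exp (1 + real n))"
    by (simp only: exp_diff) simp
  finally have "\<bar>c\<bar> * (1 + real n) ^ L * exp (- exp ((real n - 1) ^ 2)) < 1"
    using n(2) by linarith
  moreover have "c * (1 + real n) ^ L * exp (- exp ((real n - 1) ^ 2)) \<le>
      \<bar>c\<bar> * (1 + real n) ^ L * exp (- exp ((real n - 1) ^ 2))"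
    by (intro mult_right_mono) auto
  ultimately show False using *[rule_format, OF n(1)] by linarith
qed

lemma not_schwartz_equivalent_G_domain_disc: "\<not> schwartz_equivalent G_domain unit_disc"
proof
  assume "schwartz_equivalent G_domain unit_disc"
  then obtain \<phi> where diffeo: "smooth_diffeomorphism G_domain unit_disc \<phi>"
    and iso: "schwartz_isomorphism unit_disc G_domain (schwartz_pullback G_domain \<phi>)"
    unfolding schwartz_equivalent_def by blast
  define T where "T = schwartz_pullback G_domain \<phi>"
  define \<psi> where "\<psi> = inv_into G_domain \<phi>"
  have bij: "bij_betw \<phi> G_domain unit_disc"
    using diffeo by (simp add: smooth_diffeomorphism_def)
  have \<phi>: "\<phi> x \<in> unit_disc" "\<psi> (\<phi> x) = x" if "x \<in> G_domain" for x
    using bij that unfolding \<psi>_def by (auto simp: bij_betw_def simp del: mem_ball)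
  have \<psi>: "\<psi> y \<in> G_domain" "\<phi> (\<psi> y) = y" if "y \<in> unit_disc" for y
    using that bij unfolding \<psi>_def
    by (auto simp: bij_betw_def inv_into_into f_inv_into_f simp del: mem_ball)
  have "\<psi> differentiable_on unit_disc"
    using diffeo unfolding smooth_diffeomorphism_def smooth_on_def \<psi>_def
    by (metis empty_subsetI iterated_partial.simps(1) list.set(1))
  then have \<psi>_cont: "continuous_on unit_disc \<psi>"
    by (rule differentiable_imp_continuous_on)
  have T_scale: "T (\<lambda>y. c * s y) = (\<lambda>x. c * T s x)" for c s
    by (auto simp: T_def schwartz_pullback_def)
  have T_pull: "T s x = s (\<phi> x)" if "x \<in> G_domain" for s x
    using that by (simp add: T_def schwartz_pullback_def)
  obtain S where S: "homeomorphic_maps (schwartz_topology_on unit_disc) (schwartz_topology_on G_domain) T S"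
    using iso unfolding schwartz_isomorphism_def T_def homeomorphic_map_maps by blast
  then have T_cont: "continuous_map (schwartz_topology_on unit_disc) (schwartz_topology_on G_domain) T"
    and S_cont: "continuous_map (schwartz_topology_on G_domain) (schwartz_topology_on unit_disc) S"
    and ST: "\<And>s. s \<in> schwartz_space_on unit_disc \<Longrightarrow> S (T s) = s"
    and TS: "\<And>f. f \<in> schwartz_space_on G_domain \<Longrightarrow> T (S f) = f"
    unfolding homeomorphic_maps_def topspace_schwartz_topology_on by blast+
  have S_in: "S f \<in> schwartz_space_on unit_disc" if "f \<in> schwartz_space_on G_domain" for f
    using continuous_map_image_subset_topspace[OF S_cont] that
    unfolding topspace_schwartz_topology_on by blast
  \<comment> \<open>Homogeneity of \<open>S\<close>, and below its description as composition with
    \<open>\<psi>\<close>, follow from those of \<open>T\<close> because \<open>S\<close> and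
    \<open>T\<close> are mutually inverse.\<close>
  have S_scale: "S (\<lambda>x. c * f x) = (\<lambda>y. c * S f y)" if f: "f \<in> schwartz_space_on G_domain" for c f
    using ST[OF schwartz_space_on_scale[OF S_in[OF f]], of c] T_scale[of c "S f"] TS[OF f] by simp
  have S_pull: "S f y = f (\<psi> y)" if f: "f \<in> schwartz_space_on G_domain" and y: "y \<in> unit_disc" for f y
    using T_pull[OF \<psi>(1)[OF y], of "S f"] \<psi>(2)[OF y] TS[OF f] by simp
  obtain C1 N1 where C1: "C1 > 0" and est1: "\<And>x z r. \<lbrakk>x \<in> G_domain; z \<notin> G_domain; 0 < r; r \<le> 1;
      ball (\<phi> x) r \<subseteq> unit_disc\<rbrakk> \<Longrightarrow> 1 \<le> C1 * dist x z * ((1 + norm (\<phi> x)) / r) ^ N1"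
    using pullback_boundary_estimate[OF T_cont T_scale T_pull] by metis
  obtain C2 N2 where C2: "C2 > 0" and est2: "\<And>y z r. \<lbrakk>y \<in> unit_disc; z \<notin> unit_disc; 0 < r; r \<le> 1;
      ball (\<psi> y) r \<subseteq> G_domain\<rbrakk> \<Longrightarrow> 1 \<le> C2 * dist y z * ((1 + norm (\<psi> y)) / r) ^ N2"
    using pullback_boundary_estimate[OF S_cont S_scale S_pull] by metis
  have disc_iff: "y \<in> unit_disc \<longleftrightarrow> norm y < 1" for y :: "real \<times> real"
    by (simp add: dist_norm zero_prod_def[symmetric])
  have axis: "(x, 0) \<in> G_domain" if "x > 0" for x
    using that by (simp add: G_domain_axis)
  define y0 where "y0 = \<phi> (1, 0)"
  define c where "c = 1 / (1 - norm y0)"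
  have y0: "norm y0 < 1" using \<phi>(1)[OF axis[of 1]] unfolding y0_def disc_iff by simp
  then have c: "c > 0" by (simp add: c_def)
  have "1 \<le> C1 * (2 * (c + C2)) ^ N1 * (1 + real n) ^ (3 * N2 * N1) * exp (- exp ((real n - 1) ^ 2))"
    if n: "n \<ge> 3" for n
  proof -
    \<comment> \<open>The exponent 3 comes from \<open>(1 + n) / (1 / n^2) \<le> (1 + n)^3\<close>,
      where \<open>1 / n^2\<close> is the radius of the disc of the domain around
      \<open>(n, 0)\<close>.\<close>
    define q where "q = (1 + real n) ^ (3 * N2)"
    have q: "q \<ge> 1" by (simp add: q_def)
    define y where "y = \<phi> (real n, 0)"
    have nG: "(real n, 0) \<in> G_domain" using n by (intro axis) simp
    have yD: "y \<in> unit_disc" and \<psi>y: "\<psi> y = (real n, 0)"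
      using \<phi>[OF nG] by (auto simp only: y_def)
    have bound_y: "1 / (1 - norm y) \<le> C2 * q"
    proof -
      \<comment> \<open>A nearest point of the unit circle: the radial projection of
        \<open>y\<close>, or any unit vector if \<open>y = 0\<close>.\<close>
      obtain z where z: "norm z = 1" "dist y z = 1 - norm y"
      proof (cases "y = 0")
        case True
        then show ?thesis using that[of "(1, 0)"] by (simp add: norm_Pair)
      next
        case False
        have "y - sgn y = (norm y - 1) *\<^sub>R sgn y"
          using False by (simp add: sgn_div_norm scaleR_left_diff_distrib left_diff_distrib)
        then have "dist y (sgn y) = \<bar>norm y - 1\<bar>"
          using False by (simp add: dist_norm norm_sgn)
        then show ?thesis using that[of "sgn y"] False yD unfolding disc_iff by (simp add: norm_sgn)
      qed
      have "1 \<le> C2 * dist y z * ((1 + norm (\<psi> y)) / (1 / real n ^ 2)) ^ N2"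
      proof (rule est2[OF yD])
        show "z \<notin> unit_disc" using z(1) unfolding disc_iff by simp
        show "0 < 1 / real n ^ 2" using n by simp
        show "1 / real n ^ 2 \<le> 1" using n by simp
        show "ball (\<psi> y) (1 / real n ^ 2) \<subseteq> G_domain"
          unfolding \<psi>y G_domain_def using n by (intro SUP_upper2[of n] Un_upper1) simp
      qed
      also have "\<dots> \<le> C2 * dist y z * q"
      proof (intro mult_left_mono)
        have "(1 + norm (\<psi> y)) / (1 / real n ^ 2) = (1 + real n) * real n ^ 2"
          by (simp add: \<psi>y norm_Pair)
        also have "\<dots> \<le> (1 + real n) * (1 + real n) ^ 2"
          by (intro mult_left_mono power_mono) auto
        also have "\<dots> = (1 + real n) ^ 3" by (simp add: power3_eq_cube power2_eq_square)
        finally have "((1 + norm (\<psi> y)) / (1 / real n ^ 2)) ^ N2 \<le> ((1 + real n) ^ 3) ^ N2"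
          by (intro power_mono) auto
        then show "((1 + norm (\<psi> y)) / (1 / real n ^ 2)) ^ N2 \<le> q"
          by (simp only: q_def power_mult)
      qed (use C2 in auto)
      finally show ?thesis
        using yD unfolding z(2) disc_iff by (simp add: field_simps)
    qed
    \<comment> \<open>The closed disc of radius \<open>R\<close> contains \<open>y0\<close> and
      \<open>y\<close>, so its image under \<open>\<psi>\<close> is a connected set containing
      \<open>(1, 0)\<close> and \<open>(n, 0)\<close>. Its first coordinate therefore takes the
      value \<open>n - 1/2\<close>.\<close>
    define R where "R = max (norm y0) (norm y)"
    have R: "R < 1" using y0 yD unfolding R_def disc_iff by simp
    have sub: "cball 0 R \<subseteq> unit_disc"
      using R unfolding subset_iff disc_iff by (simp add: dist_norm)
    have "connected (fst ` \<psi> ` cball 0 R)"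
      using continuous_on_subset[OF \<psi>_cont sub]
      by (intro connected_continuous_image continuous_intros) (auto simp: connected_cball)
    moreover have "1 \<in> fst ` \<psi> ` cball 0 R"
    proof -
      have "y0 \<in> cball 0 R" by (simp add: R_def dist_norm)
      moreover have "\<psi> y0 = (1, 0)" unfolding y0_def by (intro \<phi>(2) axis) simp
      ultimately show ?thesis by force
    qed
    moreover have "real n \<in> fst ` \<psi> ` cball 0 R"
    proof -
      have "y \<in> cball 0 R" by (simp add: R_def dist_norm)
      then show ?thesis using \<psi>y by force
    qed
    ultimately have "real n - 1/2 \<in> fst ` \<psi> ` cball 0 R"
      by (rule connectedD_interval) (use n in auto)
    then obtain y' where y': "y' \<in> cball 0 R" "fst (\<psi> y') = real n - 1/2" by force
    then have y'D: "y' \<in> unit_disc" using sub by blast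
    define x where "x = \<psi> y'"
    have x: "x \<in> G_domain" "\<phi> x = y'" using \<psi>[OF y'D] by (auto simp only: x_def)
    obtain t where t: "x = (real n - 1/2, t)" using y'(2) by (metis x_def prod.collapse)
    \<comment> \<open>Half the width of the neck. The point at height \<open>w\<close> lies just
      outside the domain and less than \<open>2 * w\<close> away from \<open>x\<close>.\<close>
    define w where "w = (1/2) * exp (- exp ((real n - 1) ^ 2))"
    have tw: "\<bar>t\<bar> < w" using G_domain_neck[OF n] x(1) unfolding t w_def by blast
    have "(real n - 1/2, w) \<notin> G_domain" using G_domain_neck[OF n, of w] unfolding w_def by auto
    have r: "0 < 1 - R" "1 - R \<le> 1" using R by (auto simp: R_def le_max_iff_disj)
    have ball: "ball (\<phi> x) (1 - R) \<subseteq> unit_disc"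
    proof
      fix v assume "v \<in> ball (\<phi> x) (1 - R)"
      then have "norm (v - y') < 1 - R" by (simp add: x(2) dist_norm norm_minus_commute)
      moreover have "norm y' \<le> R" using y'(1) by (simp add: dist_norm)
      moreover have "norm v \<le> norm (v - y') + norm y'" using norm_triangle_ineq[of "v - y'" y'] by simp
      ultimately show "v \<in> unit_disc" unfolding disc_iff by linarith
    qed
    have "1 \<le> C1 * dist x (real n - 1/2, w) * ((1 + norm (\<phi> x)) / (1 - R)) ^ N1"
      by (rule est1) fact+
    also have "\<dots> \<le> C1 * (2 * w) * (2 * ((c + C2) * q)) ^ N1"
    proof (intro mult_mono power_mono)
      show "dist x (real n - 1/2, w) \<le> 2 * w"
        using tw by (simp add: t dist_Pair_Pair dist_real_def)
      \<comment> \<open>If \<open>R = norm y0\<close> the left side is \<open>c\<close>, otherwise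
        \<open>bound_y\<close> applies; then \<open>q \<ge> 1\<close> lets the constant
        \<open>c\<close> be absorbed into the multiple of \<open>q\<close>.\<close>
      have "1 / (1 - R) \<le> c + C2 * q"
        using bound_y c C2 q by (simp add: R_def max_def c_def add_nonneg_nonneg add_increasing add_increasing2)
      also have "\<dots> \<le> (c + C2) * q"
        using c q by (simp add: algebra_simps)
      finally have "1 / (1 - R) \<le> (c + C2) * q" .
      moreover have "1 + norm (\<phi> x) \<le> 2" using y'D unfolding x(2) disc_iff by simp
      ultimately have "(1 + norm (\<phi> x)) * (1 / (1 - R)) \<le> 2 * ((c + C2) * q)"
        using r by (intro mult_mono) auto
      then show "(1 + norm (\<phi> x)) / (1 - R) \<le> 2 * ((c + C2) * q)" by simp
    qed (use C1 r in \<open>auto simp: w_def intro!: divide_nonneg_nonneg\<close>)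
    also have "\<dots> = C1 * (2 * (c + C2)) ^ N1 * q ^ N1 * exp (- exp ((real n - 1) ^ 2))"
      by (simp add: w_def power_mult_distrib del: distrib_left_numeral)
    finally show ?thesis by (simp only: q_def power_mult)
  qed
  then show False
    using not_bounded_below_poly_times_double_exp by blast
qed

theorem mainTheorem6:
  shows "open G_domain \<and> G_domain \<noteq> UNIV \<and> simply_connected G_domain \<and>
         open unit_disc \<and> unit_disc \<noteq> UNIV \<and> simply_connected unit_disc \<and>
         smoothly_diffeomorphic G_domain unit_disc \<and>
         \<not> schwartz_equivalent G_domain unit_disc"
proof (intro conjI)
  show "G_domain \<noteq> UNIV" using G_domain_axis[of 0] by auto
  moreover have "G_domain \<noteq> {}" using G_domain_axis[of 1] by auto
  moreover show "simply_connected G_domain"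
    by (rule contractible_imp_simply_connected[OF contractible_G_domain])
  ultimately show "smoothly_diffeomorphic G_domain unit_disc"
    using open_G_domain by (intro simply_connected_smoothly_diffeomorphic_disc)
  show "unit_disc \<noteq> UNIV"
    using bounded_ball not_bounded_UNIV by metis
  show "simply_connected unit_disc"
    by (intro convex_imp_simply_connected convex_ball)
qed (intro open_ball open_G_domain not_schwartz_equivalent_G_domain_disc)+

end
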